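(* Let $I=[a,b]\subset\mathbb{R}$ be a compact interval and let $\lambda$ be the Lebesgue measure on $I$. Let $f:\mathbb{R}_+\to\mathbb{R}_+$ be convex and non-decreasing, let $U\in W^{1,1}(I)$ be such that $\int_I f(|U'(x)|)\,dx<+\infty$, and let $T:I\to\mathbb{R}$ be a non-decreasing function such that $T_\#\lambda=U_\#\lambda$. For $x\in I$ set $n(x)=\#\,U^{-1}(\{T(x)\})\in\mathbb{N}\cup\{\infty\}$. Then $$\int_I f(|U'(x)|)\,dx\;\geq\;\int_I f\big(n(x)\,T'(x)\big)\,dx .$$
   Context: $\mathbb{R}_+=[0,+\infty)$. Functions in $W^{1,1}(I)$ are real-valued and identified with their continuous representatives, so that $U^{-1}(\{y\})=\{x\in I: U(x)=y\}$ makes sense. $T_\#\lambda$ denotes the image (push-forward) measure: $T_\#\lambda(B)=\lambda(T^{-1}(B))$ for Borel $B\subset\mathbb{R}$. $T'$ is the derivative of $T$, which exists almost everywhere. Convention: if $n(x)=\infty$ and $T'(x)=0$, then $n(x)T'(x)=0$; if $n(x)=\infty$ and $T'(x)>0$, then $f(n(x)T'(x))$ is understood as $\lim_{t\to+\infty}f(t)\in[0,+\infty]$. *)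

theory Defs
  imports "HOL-Analysis.Analysis"
begin

(* Test functions: C_c^1 on the open interval (a,b), as in Brezis's definition of
   W^{1,p} on an interval ("Functional Analysis, Sobolev Spaces and PDE", Ch. 8). *)
definition C1c_test :: "real \<Rightarrow> real \<Rightarrow> (real \<Rightarrow> real) \<Rightarrow> bool" where
  "C1c_test a b \<phi> \<longleftrightarrow>
     \<phi> C1_differentiable_on UNIV \<and>
     (\<exists>K. compact K \<and> K \<subseteq> {a<..<b} \<and> (\<forall>x. x \<notin> K \<longrightarrow> \<phi> x = 0))"

(* V is an L^1 weak derivative of U; V is determined only up to null sets. *)
definition weak_derivative :: "real \<Rightarrow> real \<Rightarrow> (real \<Rightarrow> real) \<Rightarrow> (real \<Rightarrow> real) \<Rightarrow> bool" where
  "weak_derivative a b U V \<longleftrightarrow>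
     V absolutely_integrable_on {a..b} \<and>
     (\<forall>\<phi>. C1c_test a b \<phi> \<longrightarrow>
        (LINT x:{a..b}|lebesgue. U x * deriv \<phi> x) = - (LINT x:{a..b}|lebesgue. V x * \<phi> x))"

(* Functions here are not identified when they agree a.e.; the continuous representative
   has to be selected by an additional continuity assumption. *)
definition W11 :: "real \<Rightarrow> real \<Rightarrow> (real \<Rightarrow> real) set" where
  "W11 a b = {U. U absolutely_integrable_on {a..b} \<and> (\<exists>V. weak_derivative a b U V)}"

(* Cardinality of the level set, as an element of {0,1,2,...} \<union> {\<infinity>} inside ennreal. *)
definition level_count :: "real \<Rightarrow> real \<Rightarrow> (real \<Rightarrow> real) \<Rightarrow> real \<Rightarrow> ennreal" where
  "level_count a b U y = emeasure (count_space {a..b}) {x \<in> {a..b}. U x = y}"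

(* Extension of f from [0,\<infinity>) to [0,\<infinity>] by its limit at infinity. In ennreal,
   \<infinity> * 0 = 0 and \<infinity> * t = \<infinity> for t > 0. *)
definition extend_inf :: "(real \<Rightarrow> real) \<Rightarrow> ennreal \<Rightarrow> ennreal" where
  "extend_inf f t =
     (if t = \<infinity> then Lim at_top (\<lambda>s. ennreal (f s)) else ennreal (f (enn2real t)))"

end

theory Submission imports Defs begin

text \<open>Write \<open>n(y)\<close> for the number of solutions of \<open>U x = y\<close> in \<open>[a, b]\<close>. The inequality is a
conditional Jensen inequality. There is a Borel function \<open>s\<close> of the value \<open>y\<close> such that
\<open>s (T x)\<close> dominates \<open>n (T x) * T' x\<close> almost everywhere: a value taken on a
nondegenerate interval has \<open>T' = 0\<close> there, and any other value \<open>y\<close> determines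
the point \<open>x\<close> with \<open>T x = y\<close>. For every Borel \<open>g \<ge> 0\<close>, all integrals being over
\<open>[a, b]\<close> except those in \<open>y\<close>,
\<open>\<integral> g(U) s(U) = \<integral> g(T) s(T) \<le> \<integral> g(y) n(y) dy \<le> \<integral> g(U) |U'|\<close>,
where, strictly speaking, \<open>n\<close> is replaced by a Borel majorant \<open>N\<close> that satisfies the last inequality.
The equality holds because \<open>T\<close> and \<open>U\<close> have the same distribution; the next step is
the substitution inequality for a monotone function (\<open>nn_integral_mono_substitution_le\<close>);
the last one bounds the Banach indicatrix (\<open>level_count_nn_integral_le\<close>).
So \<open>s(U)\<close> is at most the conditional expectation of \<open>|U'|\<close> given \<open>U\<close>, and integrating
supporting lines of \<open>f\<close> (\<open>Jensen_conditional_bound\<close>) gives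
\<open>\<integral> f(s(U)) \<le> \<integral> f(|U'|)\<close>. The left side equals \<open>\<integral> f(s(T))\<close>, which dominates
\<open>\<integral> f(n(T) T')\<close>. Taking \<open>g = 1\<close> shows that \<open>s(T)\<close> is finite almost everywhere, so
the value of \<open>f\<close> at infinity never matters.

Two classical facts are needed besides. A monotone function is differentiable almost
everywhere (\<open>negligible_mono_nondifferentiable\<close>, by Vitali coverings), without which
\<open>deriv T\<close> carries no information. And the increments of the continuous function \<open>U\<close> are
bounded by the integral of \<open>|U'|\<close> (\<open>weak_derivative_increment_le\<close>, by testing the weak
derivative against smoothed indicator functions of intervals).\<close>

section \<open>Differentiability of monotone functions\<close>

text \<open>Monotonicity carries disjoint closed intervals \<open>[c, d]\<close> to disjoint open intervals
\<open>(F c, F d)\<close>. Sums of increments thus become Lebesgue measures, and they can be compared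
through inclusions without any continuity of \<open>F\<close>. An interval \<open>[c, d]\<close> is encoded as the
pair of its endpoints.\<close>

lemma nn_integral_increments_eq_emeasure:
  fixes F :: "real \<Rightarrow> real"
  assumes F: "mono F" and C: "countable C" "\<And>p. p \<in> C \<Longrightarrow> fst p < snd p"
    and disj: "pairwise (\<lambda>p q. disjnt {fst p..snd p} {fst q..snd q}) C"
  shows "(\<integral>\<^sup>+p. ennreal (F (snd p) - F (fst p)) \<partial>count_space C)
       = emeasure lborel (\<Union>p\<in>C. {F (fst p)<..<F (snd p)})"
proof -
  have "{F (fst p)<..<F (snd p)} \<inter> {F (fst q)<..<F (snd q)} = {}" if "p \<in> C" "q \<in> C" "p \<noteq> q" for p q
  proof -
    have d: "{fst p..snd p} \<inter> {fst q..snd q} = {}"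
      using disj that by (auto simp: pairwise_def disjnt_def)
    have "snd p < fst q \<or> snd q < fst p"
    proof (rule ccontr)
      assume "\<not> ?thesis"
      then have "max (fst p) (fst q) \<in> {fst p..snd p} \<inter> {fst q..snd q}"
        using C(2)[OF that(1)] C(2)[OF that(2)] by auto
      with d show False by blast
    qed
    then show ?thesis
    proof
      assume "snd p < fst q"
      with F have "F (snd p) \<le> F (fst q)" by (simp add: monoD)
      then show ?thesis by auto
    next
      assume "snd q < fst p"
      with F have "F (snd q) \<le> F (fst p)" by (simp add: monoD)
      then show ?thesis by auto
    qed
  qed
  then have "disjoint_family_on (\<lambda>p. {F (fst p)<..<F (snd p)}) C"
    by (auto simp: disjoint_family_on_def)
  with C(1) have "emeasure lborel (\<Union>p\<in>C. {F (fst p)<..<F (snd p)})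
      = (\<integral>\<^sup>+p. emeasure lborel {F (fst p)<..<F (snd p)} \<partial>count_space C)"
    by (intro emeasure_UN_countable) auto
  also have "\<dots> = (\<integral>\<^sup>+p. ennreal (F (snd p) - F (fst p)) \<partial>count_space C)"
    using C(2) F by (intro nn_integral_cong) (auto simp: mono_def less_imp_le)
  finally show ?thesis by simp
qed

lemma Vitali_covering_real:
  fixes E :: "real set" and K :: "(real \<times> real) set"
  assumes K: "\<And>p. p \<in> K \<Longrightarrow> fst p < snd p"
    and E: "\<And>x d. x \<in> E \<Longrightarrow> 0 < d \<Longrightarrow> \<exists>p\<in>K. x \<in> {fst p..snd p} \<and> snd p - fst p < d"
  obtains C where "countable C" "C \<subseteq> K"
    "pairwise (\<lambda>p q. disjnt {fst p..snd p} {fst q..snd q}) C"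
    "negligible (E - (\<Union>p\<in>C. {fst p..snd p}))"
proof -
  have cb: "cball ((fst p + snd p) / 2) ((snd p - fst p) / 2) = {fst p..snd p}" for p :: "real \<times> real"
    by (simp add: cball_eq_atLeastAtMost field_simps)
  show thesis
  proof (rule Vitali_covering_theorem_cballs
      [of K "\<lambda>p. (snd p - fst p) / 2" E "\<lambda>p. (fst p + snd p) / 2"])
    show "0 < (snd p - fst p) / 2" if "p \<in> K" for p
      using K[OF that] by simp
    show "\<exists>p. p \<in> K \<and> x \<in> cball ((fst p + snd p) / 2) ((snd p - fst p) / 2) \<and> (snd p - fst p) / 2 < d"
      if "x \<in> E" "0 < d" for x d
    proof -
      obtain p where "p \<in> K" "x \<in> {fst p..snd p}" "snd p - fst p < d"
        using E[of x d] \<open>x \<in> E\<close> \<open>0 < d\<close> by auto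
      moreover have "(snd p - fst p) / 2 < d"
        using K[OF \<open>p \<in> K\<close>] \<open>snd p - fst p < d\<close> by simp
      ultimately show ?thesis unfolding cb by blast
    qed
  qed (auto simp only: cb intro: that)
qed

lemma outer_measure_of_le_negligible:
  assumes "E \<subseteq> A \<union> N" "A \<in> sets lebesgue" "negligible N"
  shows "outer_measure_of lebesgue E \<le> emeasure lebesgue A"
proof -
  have N: "N \<in> null_sets lebesgue" using assms(3) by (simp add: negligible_iff_null_sets)
  have "outer_measure_of lebesgue E \<le> emeasure lebesgue (A \<union> N)"
    unfolding outer_measure_of_def using assms N by (intro INF_lower) auto
  also have "\<dots> = emeasure lebesgue A" using N assms(2) by (simp add: emeasure_Un_null_set)
  finally show ?thesis .
qed

lemma emeasure_UN_intervals:
  assumes "countable C" "\<And>p. p \<in> C \<Longrightarrow> fst p < snd p"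
    and "pairwise (\<lambda>p q. disjnt {fst p..snd p} {fst q..snd q}) C"
  shows "emeasure lebesgue (\<Union>p\<in>C. {fst p..snd p::real}) = (\<integral>\<^sup>+p. ennreal (snd p - fst p) \<partial>count_space C)"
proof -
  have "(\<Union>p\<in>C. {fst p..snd p}) \<in> sets lborel"
    using assms(1) by (intro sets.countable_UN') auto
  then have "emeasure lebesgue (\<Union>p\<in>C. {fst p..snd p}) = emeasure lborel (\<Union>p\<in>C. {fst p..snd p})"
    by simp
  also have "\<dots> = (\<integral>\<^sup>+p. emeasure lborel {fst p..snd p} \<partial>count_space C)"
    using assms by (intro emeasure_UN_countable)
      (auto simp: disjoint_family_on_def pairwise_def disjnt_def)
  also have "\<dots> = (\<integral>\<^sup>+p. ennreal (snd p - fst p) \<partial>count_space C)"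
    using assms(2) by (intro nn_integral_cong) (auto simp: less_imp_le)
  finally show ?thesis .
qed

text \<open>If near every point of \<open>E\<close> the function \<open>F\<close> increases by a factor more than \<open>\<alpha>\<close> on
arbitrarily short intervals, then the total increment over any countable disjoint family of intervals
that covers almost all of \<open>E\<close> is at least \<open>\<alpha>\<close> times the outer measure of \<open>E\<close>. The set \<open>E\<close>
is arbitrary, which spares a discussion of the measurability of Dini derivatives.\<close>

lemma outer_measure_of_le_increments:
  fixes F :: "real \<Rightarrow> real"
  assumes F: "mono F" and "0 < \<alpha>"
    and C: "countable C" "\<And>p. p \<in> C \<Longrightarrow> fst p < snd p"
      "pairwise (\<lambda>p q. disjnt {fst p..snd p} {fst q..snd q}) C"
    and sub: "negligible (E - (\<Union>p\<in>C. {fst p..snd p}))"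
    and big: "\<And>x \<delta>. x \<in> E \<Longrightarrow> 0 < \<delta> \<Longrightarrow>
        \<exists>c d. c < d \<and> x \<in> {c..d} \<and> d - c < \<delta> \<and> \<alpha> * (d - c) < F d - F c"
  shows "ennreal \<alpha> * outer_measure_of lebesgue E \<le> (\<integral>\<^sup>+p. ennreal (F (snd p) - F (fst p)) \<partial>count_space C)"
proof -
  \<comment> \<open>Points that are endpoints of the given intervals are discarded: short intervals around them may stick out.\<close>
  define E' where "E' = E \<inter> (\<Union>p\<in>C. {fst p<..<snd p})"
  define K where "K = {q. fst q < snd q \<and> \<alpha> * (snd q - fst q) < F (snd q) - F (fst q) \<and>
      (\<exists>p\<in>C. {fst q..snd q} \<subseteq> {fst p<..<snd p})}"
  have cov: "\<exists>p\<in>K. x \<in> {fst p..snd p} \<and> snd p - fst p < \<delta>" if "x \<in> E'" "0 < \<delta>" for x \<delta>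
  proof -
    obtain p where p: "p \<in> C" "x \<in> {fst p<..<snd p}" "x \<in> E" using \<open>x \<in> E'\<close> by (auto simp: E'_def)
    define \<eta> where "\<eta> = min \<delta> (min (x - fst p) (snd p - x))"
    have "0 < \<eta>" using p that by (auto simp: \<eta>_def)
    obtain c d where cd: "c < d" "x \<in> {c..d}" "d - c < \<eta>" "\<alpha> * (d - c) < F d - F c"
      using big[OF \<open>x \<in> E\<close> \<open>0 < \<eta>\<close>] by blast
    have "{c..d} \<subseteq> {fst p<..<snd p}" using cd(2,3) unfolding \<eta>_def by auto
    with cd p(1) have "(c, d) \<in> K" by (auto simp: K_def)
    moreover have "d - c < \<delta>" using cd(3) by (simp add: \<eta>_def)
    ultimately show ?thesis using cd(2) by (intro bexI[of _ "(c, d)"]) auto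
  qed
  obtain J where J: "countable J" "J \<subseteq> K"
    "pairwise (\<lambda>p q. disjnt {fst p..snd p} {fst q..snd q}) J"
    "negligible (E' - (\<Union>p\<in>J. {fst p..snd p}))"
    using Vitali_covering_real[of K E'] cov by (auto simp: K_def)
  have J_less: "fst p < snd p" if "p \<in> J" for p using that J(2) by (auto simp: K_def)
  have "countable (fst ` C \<union> snd ` C)" using C(1) by simp
  then have "negligible (fst ` C \<union> snd ` C)" by (simp add: negligible_iff_null_sets countable_imp_null_set_lborel null_sets_completionI)
  then have neg: "negligible ((E' - (\<Union>p\<in>J. {fst p..snd p})) \<union>
      ((E - (\<Union>p\<in>C. {fst p..snd p})) \<union> (fst ` C \<union> snd ` C)))"
    using J(4) sub by (blast intro: negligible_Un)
  have "outer_measure_of lebesgue E \<le> emeasure lebesgue (\<Union>p\<in>J. {fst p..snd p})"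
  proof (rule outer_measure_of_le_negligible[OF _ _ neg])
    show "(\<Union>p\<in>J. {fst p..snd p}) \<in> sets lebesgue"
      using J(1) by (intro sets.countable_UN') auto
    show "E \<subseteq> (\<Union>p\<in>J. {fst p..snd p}) \<union> ((E' - (\<Union>p\<in>J. {fst p..snd p})) \<union>
      ((E - (\<Union>p\<in>C. {fst p..snd p})) \<union> (fst ` C \<union> snd ` C)))"
    proof
      fix x assume "x \<in> E"
      have "x \<in> E' \<or> x \<in> fst ` C \<union> snd ` C" if x: "x \<in> (\<Union>p\<in>C. {fst p..snd p})"
      proof -
        obtain p where p: "p \<in> C" "x \<in> {fst p..snd p}" using x by blast
        show ?thesis
        proof (cases "x = fst p \<or> x = snd p")
          case False
          with p \<open>x \<in> E\<close> show ?thesis by (auto simp: E'_def intro!: bexI[of _ p])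
        qed (use p(1) in auto)
      qed
      with \<open>x \<in> E\<close> show "x \<in> (\<Union>p\<in>J. {fst p..snd p}) \<union> ((E' - (\<Union>p\<in>J. {fst p..snd p})) \<union>
      ((E - (\<Union>p\<in>C. {fst p..snd p})) \<union> (fst ` C \<union> snd ` C)))" by blast
    qed
  qed
  also have "\<dots> = (\<integral>\<^sup>+p. ennreal (snd p - fst p) \<partial>count_space J)"
    by (rule emeasure_UN_intervals[OF J(1) J_less J(3)])
  finally have "ennreal \<alpha> * outer_measure_of lebesgue E
      \<le> ennreal \<alpha> * (\<integral>\<^sup>+p. ennreal (snd p - fst p) \<partial>count_space J)"
    by (rule mult_left_mono) simp
  also have "\<dots> = (\<integral>\<^sup>+p. ennreal \<alpha> * ennreal (snd p - fst p) \<partial>count_space J)"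
    by (simp add: nn_integral_cmult)
  also have "\<dots> \<le> (\<integral>\<^sup>+p. ennreal (F (snd p) - F (fst p)) \<partial>count_space J)"
  proof (intro nn_integral_mono)
    fix p assume "p \<in> space (count_space J)"
    then have "p \<in> K" using J(2) by auto
    then show "ennreal \<alpha> * ennreal (snd p - fst p) \<le> ennreal (F (snd p) - F (fst p))"
      using \<open>0 < \<alpha>\<close> by (auto simp: K_def ennreal_mult'[symmetric] intro!: ennreal_leI)
  qed
  also have "\<dots> = emeasure lborel (\<Union>p\<in>J. {F (fst p)<..<F (snd p)})"
    by (rule nn_integral_increments_eq_emeasure[OF F J(1) J_less J(3)])
  also have "\<dots> \<le> emeasure lborel (\<Union>p\<in>C. {F (fst p)<..<F (snd p)})"
  proof (intro emeasure_mono)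
    show "(\<Union>p\<in>J. {F (fst p)<..<F (snd p)}) \<subseteq> (\<Union>p\<in>C. {F (fst p)<..<F (snd p)})"
    proof (intro UN_least)
      fix q assume "q \<in> J"
      then obtain p where p: "p \<in> C" "{fst q..snd q} \<subseteq> {fst p<..<snd p}" and "fst q < snd q"
        using J(2) by (auto simp: K_def)
      then have "fst q \<in> {fst p<..<snd p}" "snd q \<in> {fst p<..<snd p}" by (meson atLeastAtMost_iff less_imp_le order_refl subsetD)+
      then have "fst p \<le> fst q" "snd q \<le> snd p" by auto
      with F have "F (fst p) \<le> F (fst q)" "F (snd q) \<le> F (snd p)" by (auto simp: mono_def)
      with p(1) show "{F (fst q)<..<F (snd q)} \<subseteq> (\<Union>p\<in>C. {F (fst p)<..<F (snd p)})"
        by (auto intro!: bexI[of _ p])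
    qed
    show "(\<Union>p\<in>C. {F (fst p)<..<F (snd p)}) \<in> sets lborel"
      using C(1) by (intro sets.countable_UN') auto
  qed
  also have "\<dots> = (\<integral>\<^sup>+p. ennreal (F (snd p) - F (fst p)) \<partial>count_space C)"
    by (rule nn_integral_increments_eq_emeasure[OF F C, symmetric])
  finally show ?thesis .
qed

lemma negligible_outer_measure_of_zero:
  assumes "outer_measure_of lebesgue E = 0"
  shows "negligible E"
proof -
  obtain B where B: "B \<in> sets lebesgue" "E \<subseteq> B" "outer_measure_of lebesgue E = emeasure lebesgue B"
    using outer_measure_of_attain[of E lebesgue] by auto
  then have "B \<in> null_sets lebesgue" using assms by auto
  then have "negligible B" by (simp add: negligible_iff_null_sets)
  then show ?thesis using B(2) by (rule negligible_subset)
qed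

text \<open>Points at which the difference quotients oscillate across \<open>[\<beta>, \<alpha>]\<close>. With \<open>m\<close> the outer
measure of the set, a first Vitali covering inside an open set of measure close to \<open>m\<close> has
total increment at most about \<open>\<beta> * m\<close>; by the previous estimate that increment
is at least \<open>\<alpha> * m\<close>.\<close>

lemma negligible_oscillating_increments:
  fixes F :: "real \<Rightarrow> real"
  assumes F: "mono F" and "0 < \<beta>" "\<beta> < \<alpha>" and "bounded E"
    and big: "\<And>x \<delta>. x \<in> E \<Longrightarrow> 0 < \<delta> \<Longrightarrow>
        \<exists>c d. c < d \<and> x \<in> {c..d} \<and> d - c < \<delta> \<and> \<alpha> * (d - c) < F d - F c"
    and small: "\<And>x \<delta>. x \<in> E \<Longrightarrow> 0 < \<delta> \<Longrightarrow>
        \<exists>c d. c < d \<and> x \<in> {c..d} \<and> d - c < \<delta> \<and> F d - F c < \<beta> * (d - c)"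
  shows "negligible E"
proof -
  define m where "m = outer_measure_of lebesgue E"
  obtain B where B: "B \<in> sets lebesgue" "E \<subseteq> B" "m = emeasure lebesgue B"
    using outer_measure_of_attain[of E lebesgue] by (auto simp: m_def)
  obtain R where R: "E \<subseteq> cball 0 R"
    using \<open>bounded E\<close> by (meson bounded_subset_ballD order_trans ball_subset_cball)
  have "m \<le> emeasure lebesgue (cball (0::real) R)"
    unfolding m_def by (rule outer_measure_of_le_negligible[of _ _ "{}"]) (use R in auto)
  also have "\<dots> < \<infinity>" using emeasure_lborel_cball_finite[of "0::real" R] by simp
  finally have fin: "m < \<infinity>" .
  have le: "ennreal \<alpha> * m \<le> ennreal \<beta> * (m + ennreal \<epsilon>)" if "0 < \<epsilon>" for \<epsilon>
  proof -
    obtain G where G: "open G" "B \<subseteq> G" "G - B \<in> lmeasurable" "emeasure lebesgue (G - B) < ennreal \<epsilon>"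
      using sets_lebesgue_outer_open[OF B(1) \<open>0 < \<epsilon>\<close>] .
    define K where "K = {p. fst p < snd p \<and> F (snd p) - F (fst p) < \<beta> * (snd p - fst p) \<and> {fst p..snd p} \<subseteq> G}"
    have cov: "\<exists>p\<in>K. x \<in> {fst p..snd p} \<and> snd p - fst p < \<delta>" if "x \<in> E" "0 < \<delta>" for x \<delta>
    proof -
      have "x \<in> G" using B(2) G(2) that by auto
      then obtain e where e: "0 < e" "ball x e \<subseteq> G" using G(1) openE by blast
      obtain c d where cd: "c < d" "x \<in> {c..d}" "d - c < min e \<delta>" "F d - F c < \<beta> * (d - c)"
        using small[OF \<open>x \<in> E\<close>, of "min e \<delta>"] e \<open>0 < \<delta>\<close> by auto
      have "{c..d} \<subseteq> ball x e" using cd(2,3) by (auto simp: dist_real_def)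
      with e cd have "(c, d) \<in> K" by (auto simp: K_def)
      then show ?thesis using cd by (intro bexI[of _ "(c, d)"]) auto
    qed
    obtain C where C: "countable C" "C \<subseteq> K"
      "pairwise (\<lambda>p q. disjnt {fst p..snd p} {fst q..snd q}) C"
      "negligible (E - (\<Union>p\<in>C. {fst p..snd p}))"
      using Vitali_covering_real[of K E] cov by (auto simp: K_def)
    have C_less: "fst p < snd p" if "p \<in> C" for p using that C(2) by (auto simp: K_def)
    have "ennreal \<alpha> * m \<le> (\<integral>\<^sup>+p. ennreal (F (snd p) - F (fst p)) \<partial>count_space C)"
      unfolding m_def
      by (rule outer_measure_of_le_increments[OF F _ C(1) C_less C(3,4) big]) (use assms in auto)
    also have "\<dots> \<le> (\<integral>\<^sup>+p. ennreal \<beta> * ennreal (snd p - fst p) \<partial>count_space C)"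
      using C(2) \<open>0 < \<beta>\<close> by (intro nn_integral_mono)
        (force simp: K_def ennreal_mult'[symmetric] intro!: ennreal_leI)
    also have "\<dots> = ennreal \<beta> * emeasure lebesgue (\<Union>p\<in>C. {fst p..snd p})"
      by (simp add: nn_integral_cmult emeasure_UN_intervals[OF C(1) C_less C(3)])
    also have "\<dots> \<le> ennreal \<beta> * emeasure lebesgue G"
      using C(2) G(1) by (intro mult_left_mono emeasure_mono) (auto simp: K_def)
    also have "emeasure lebesgue G = emeasure lebesgue (B \<union> (G - B))"
      using G(2) by (simp add: Un_absorb1)
    also have "\<dots> \<le> m + emeasure lebesgue (G - B)"
      unfolding B(3) using B(1) G(3) by (intro emeasure_subadditive) (auto dest: fmeasurableD)
    also have "\<dots> \<le> m + ennreal \<epsilon>" using G(4) by (intro add_left_mono) auto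
    finally show ?thesis by (simp add: mult_left_mono)
  qed
  obtain r where r: "m = ennreal r" "0 \<le> r" using fin by (cases m) auto
  have "\<alpha> * r \<le> \<beta> * (r + \<epsilon>)" if "0 < \<epsilon>" for \<epsilon> :: real
    using le[OF that] that r \<open>0 < \<beta>\<close> \<open>\<beta> < \<alpha>\<close>
    by (simp add: ennreal_mult'[symmetric] ennreal_plus[symmetric] del: ennreal_plus)
  then have "(\<alpha> * r - \<beta> * r) \<le> 0 + \<epsilon>" if "0 < \<epsilon>" for \<epsilon> :: real
    using \<open>\<And>\<epsilon>. 0 < \<epsilon> \<Longrightarrow> \<alpha> * r \<le> \<beta> * (r + \<epsilon>)\<close>[of "\<epsilon> / \<beta>"] that \<open>0 < \<beta>\<close>
    by (simp add: distrib_left)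
  then have "\<alpha> * r - \<beta> * r \<le> 0" by (rule field_le_epsilon)
  then have "(\<alpha> - \<beta>) * r \<le> 0" by (simp add: algebra_simps)
  with \<open>\<beta> < \<alpha>\<close> r(2) have "r = 0" by (simp add: mult_le_0_iff)
  with r have "m = 0" by simp
  then show ?thesis unfolding m_def by (rule negligible_outer_measure_of_zero)
qed

lemma negligible_unbounded_increments:
  fixes F :: "real \<Rightarrow> real"
  assumes F: "mono F" and "bounded E"
    and big: "\<And>x \<alpha> \<delta>. x \<in> E \<Longrightarrow> 0 < \<alpha> \<Longrightarrow> 0 < \<delta> \<Longrightarrow>
        \<exists>c d. c < d \<and> x \<in> {c..d} \<and> d - c < \<delta> \<and> \<alpha> * (d - c) < F d - F c"
  shows "negligible E"
proof -
  obtain R where R: "E \<subseteq> cball 0 R" "0 < R" using \<open>bounded E\<close> by (meson bounded_subset_ballD order_trans ball_subset_cball)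
  define m where "m = outer_measure_of lebesgue E"
  \<comment> \<open>The single interval \<open>[-R, R]\<close> covers \<open>E\<close>, and \<open>\<alpha>\<close> is arbitrary.\<close>
  have le: "ennreal \<alpha> * m \<le> ennreal (F R - F (- R))" if "0 < \<alpha>" for \<alpha>
  proof -
    have "E - (\<Union>p\<in>{(-R, R)}. {fst p..snd p}) = {}"
      using R(1) by (auto simp: cball_eq_atLeastAtMost)
    then have "ennreal \<alpha> * m \<le> (\<integral>\<^sup>+p. ennreal (F (snd p) - F (fst p)) \<partial>count_space {(-R, R)})"
      unfolding m_def using R(2) that
      by (intro outer_measure_of_le_increments[OF F] big) auto
    also have "\<dots> = ennreal (F R - F (- R))" by (simp add: nn_integral_count_space_finite)
    finally show ?thesis .
  qed
  have "m < \<infinity>"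
    using le[of 1] by (auto simp: less_top[symmetric] top_unique)
  then obtain r where r: "m = ennreal r" "0 \<le> r" by (cases m) auto
  have D: "0 \<le> F R - F (-R)" using F R(2) by (simp add: mono_def)
  have "\<alpha> * r \<le> F R - F (-R)" if "0 < \<alpha>" for \<alpha>
    using le[OF that] that D r by (simp add: ennreal_mult'[symmetric])
  have "r = 0"
  proof (rule ccontr)
    assume "r \<noteq> 0"
    with r have "0 < r" by simp
    then have "((F R - F (-R) + 1) / r) * r \<le> F R - F (-R)"
      using D by (intro \<open>\<And>\<alpha>. 0 < \<alpha> \<Longrightarrow> \<alpha> * r \<le> F R - F (-R)\<close>) auto
    with \<open>0 < r\<close> show False by simp
  qed
  with r have "m = 0" by simp
  then show ?thesis unfolding m_def by (rule negligible_outer_measure_of_zero)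
qed

text \<open>The difference quotients are taken over all short intervals containing \<open>x\<close>, in the interior
or as an endpoint. If they are bounded and do not oscillate across any pair of rationals,
they converge.\<close>

lemma differentiable_if_increments_converge:
  fixes F :: "real \<Rightarrow> real"
  assumes F: "mono F" and "0 < \<alpha>\<^sub>0" "0 < \<delta>\<^sub>0"
    and bdd: "\<And>c d. c < d \<Longrightarrow> x \<in> {c..d} \<Longrightarrow> d - c < \<delta>\<^sub>0 \<Longrightarrow> F d - F c \<le> \<alpha>\<^sub>0 * (d - c)"
    and alt: "\<And>\<beta> \<alpha>. \<beta> \<in> \<rat> \<Longrightarrow> \<alpha> \<in> \<rat> \<Longrightarrow> 0 < \<beta> \<Longrightarrow> \<beta> < \<alpha> \<Longrightarrow>
        (\<exists>\<delta>>0. \<forall>c d. c < d \<longrightarrow> x \<in> {c..d} \<longrightarrow> d - c < \<delta> \<longrightarrow> F d - F c \<le> \<alpha> * (d - c)) \<or>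
        (\<exists>\<delta>>0. \<forall>c d. c < d \<longrightarrow> x \<in> {c..d} \<longrightarrow> d - c < \<delta> \<longrightarrow> \<beta> * (d - c) \<le> F d - F c)"
  shows "F differentiable at x"
proof -
  define up where "up \<alpha> \<longleftrightarrow> (\<exists>\<delta>>0. \<forall>c d. c < d \<longrightarrow> x \<in> {c..d} \<longrightarrow> d - c < \<delta> \<longrightarrow> F d - F c \<le> \<alpha> * (d - c))" for \<alpha>
  define low where "low \<beta> \<longleftrightarrow> (\<exists>\<delta>>0. \<forall>c d. c < d \<longrightarrow> x \<in> {c..d} \<longrightarrow> d - c < \<delta> \<longrightarrow> \<beta> * (d - c) \<le> F d - F c)" for \<beta>
  have up0: "up \<alpha>\<^sub>0" unfolding up_def using bdd \<open>0 < \<delta>\<^sub>0\<close> by blast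
  have up_mono: "up \<alpha>'" if "up \<alpha>" "\<alpha> \<le> \<alpha>'" for \<alpha> \<alpha>'
  proof -
    obtain \<delta> where "\<delta> > 0" "\<And>c d. c < d \<Longrightarrow> x \<in> {c..d} \<Longrightarrow> d - c < \<delta> \<Longrightarrow> F d - F c \<le> \<alpha> * (d - c)"
      using \<open>up \<alpha>\<close> unfolding up_def by blast
    moreover have "\<alpha> * (d - c) \<le> \<alpha>' * (d - c)" if "c < d" for c d :: real
      using \<open>\<alpha> \<le> \<alpha>'\<close> that by (intro mult_right_mono) auto
    ultimately show ?thesis unfolding up_def by (meson order_trans)
  qed
  have low_mono: "low \<beta>'" if "low \<beta>" "\<beta>' \<le> \<beta>" for \<beta> \<beta>'
  proof -
    obtain \<delta> where "\<delta> > 0" "\<And>c d. c < d \<Longrightarrow> x \<in> {c..d} \<Longrightarrow> d - c < \<delta> \<Longrightarrow> \<beta> * (d - c) \<le> F d - F c"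
      using \<open>low \<beta>\<close> unfolding low_def by blast
    moreover have "\<beta>' * (d - c) \<le> \<beta> * (d - c)" if "c < d" for c d :: real
      using \<open>\<beta>' \<le> \<beta>\<close> that by (intro mult_right_mono) auto
    ultimately show ?thesis unfolding low_def by (meson order_trans)
  qed
  have low0: "low 0" unfolding low_def using F by (auto intro!: exI[of _ 1] simp: mono_def)
  have up_nonneg: "0 \<le> \<alpha>" if "up \<alpha>" for \<alpha>
  proof -
    obtain \<delta> where \<delta>: "\<delta> > 0" "\<And>c d. c < d \<Longrightarrow> x \<in> {c..d} \<Longrightarrow> d - c < \<delta> \<Longrightarrow> F d - F c \<le> \<alpha> * (d - c)"
      using \<open>up \<alpha>\<close> unfolding up_def by blast
    have "F (x + \<delta>/2) - F x \<le> \<alpha> * (\<delta>/2)" using \<delta>(2)[of x "x + \<delta>/2"] \<delta>(1) by auto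
    moreover have "F x \<le> F (x + \<delta>/2)" using F \<delta>(1) by (simp add: mono_def)
    ultimately have "0 \<le> \<alpha> * (\<delta>/2)" by linarith
    with \<delta>(1) show ?thesis by (simp add: zero_le_mult_iff)
  qed
  define L where "L = Inf {\<alpha>. up \<alpha>}"
  have bb: "bdd_below {\<alpha>. up \<alpha>}" using up_nonneg by (intro bdd_belowI[of _ 0]) auto
  have upL: "up (L + \<epsilon>)" if "0 < \<epsilon>" for \<epsilon>
  proof -
    have "Inf {\<alpha>. up \<alpha>} < L + \<epsilon>" using that by (simp add: L_def)
    then obtain \<alpha> where "up \<alpha>" "\<alpha> < L + \<epsilon>" using up0 cInf_lessD[of "{\<alpha>. up \<alpha>}"] by blast
    then show ?thesis using up_mono by (meson less_imp_le)
  qed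
  have lowL: "low (L - \<epsilon>)" if "0 < \<epsilon>" for \<epsilon>
  proof (cases "L - \<epsilon> \<le> 0")
    case True
    then show ?thesis using low0 low_mono by blast
  next
    case False
    obtain \<beta> where \<beta>: "\<beta> \<in> \<rat>" "L - \<epsilon> < \<beta>" "\<beta> < L"
      using Rats_dense_in_real[of "L - \<epsilon>" L] \<open>0 < \<epsilon>\<close> by auto
    obtain \<alpha> where \<alpha>: "\<alpha> \<in> \<rat>" "\<beta> < \<alpha>" "\<alpha> < L"
      using Rats_dense_in_real[of \<beta> L] \<beta> by auto
    have "\<not> up \<alpha>"
    proof
      assume "up \<alpha>"
      then have "L \<le> \<alpha>" unfolding L_def by (intro cInf_lower bb) auto
      with \<alpha> show False by simp
    qed
    then have "low \<beta>" using alt[OF \<beta>(1) \<alpha>(1)] \<alpha>(2) \<beta>(2) False unfolding up_def low_def by auto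
    then show ?thesis using low_mono \<beta>(2) by (meson less_imp_le)
  qed
  have "(F has_real_derivative L) (at x)"
    unfolding has_field_derivative_def has_derivative_at_alt
  proof (intro conjI allI impI)
    show "bounded_linear ((*) L)" by (rule bounded_linear_mult_right)
    fix \<epsilon> :: real assume "0 < \<epsilon>"
    obtain \<delta>1 where \<delta>1: "\<delta>1 > 0" "\<And>c d. c < d \<Longrightarrow> x \<in> {c..d} \<Longrightarrow> d - c < \<delta>1 \<Longrightarrow> F d - F c \<le> (L + \<epsilon>) * (d - c)"
      using upL[OF \<open>0 < \<epsilon>\<close>] unfolding up_def by blast
    obtain \<delta>2 where \<delta>2: "\<delta>2 > 0" "\<And>c d. c < d \<Longrightarrow> x \<in> {c..d} \<Longrightarrow> d - c < \<delta>2 \<Longrightarrow> (L - \<epsilon>) * (d - c) \<le> F d - F c"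
      using lowL[OF \<open>0 < \<epsilon>\<close>] unfolding low_def by blast
    have "norm (F y - F x - L * (y - x)) \<le> \<epsilon> * norm (y - x)" if "norm (y - x) < min \<delta>1 \<delta>2" for y
    proof (cases y x rule: linorder_cases)
      case less
      then show ?thesis using \<delta>1(2)[of y x] \<delta>2(2)[of y x] that by (auto simp: algebra_simps abs_le_iff)
    next
      case greater
      then show ?thesis using \<delta>1(2)[of x y] \<delta>2(2)[of x y] that by (auto simp: algebra_simps abs_le_iff)
    qed simp
    with \<delta>1(1) \<delta>2(1) show "\<exists>d>0. \<forall>y. norm (y - x) < d \<longrightarrow> norm (F y - F x - L * (y - x)) \<le> \<epsilon> * norm (y - x)"
      by (intro exI[of _ "min \<delta>1 \<delta>2"]) simp
  qed
  then show ?thesis using real_differentiable_def by blast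
qed

text \<open>Lebesgue's theorem on the differentiability of monotone functions.\<close>

theorem negligible_mono_nondifferentiable:
  fixes F :: "real \<Rightarrow> real"
  assumes F: "mono F"
  shows "negligible {x. \<not> F differentiable at x}"
proof -
  define big where "big x \<alpha> \<longleftrightarrow> (\<forall>\<delta>>0. \<exists>c d. c < d \<and> x \<in> {c..d} \<and> d - c < \<delta> \<and> \<alpha> * (d - c) < F d - F c)" for x \<alpha>
  define small where "small x \<beta> \<longleftrightarrow> (\<forall>\<delta>>0. \<exists>c d. c < d \<and> x \<in> {c..d} \<and> d - c < \<delta> \<and> F d - F c < \<beta> * (d - c))" for x \<beta>
  \<comment> \<open>Restricting to \<open>|x| \<le> R\<close> keeps the outer measures finite.\<close>
  define E where "E = (\<lambda>(R::nat, \<beta>, \<alpha>). {x \<in> cball 0 (real R). big x \<alpha> \<and> small x \<beta>})"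
  define Z where "Z R = {x \<in> cball 0 (real R). \<forall>\<alpha>>0. big x \<alpha>}" for R :: nat
  define P where "P = {(R::nat, \<beta>, \<alpha>). \<beta> \<in> \<rat> \<and> \<alpha> \<in> \<rat> \<and> 0 < \<beta> \<and> \<beta> < (\<alpha>::real)}"
  have "countable ((UNIV :: nat set) \<times> (\<rat> :: real set) \<times> (\<rat> :: real set))"
    by (intro countable_SIGMA) (auto intro: countable_rat)
  then have "countable P" by (rule countable_subset[rotated]) (auto simp: P_def)
  have negE: "negligible (E p)" if "p \<in> P" for p
  proof -
    obtain R \<beta> \<alpha> where p: "p = (R, \<beta>, \<alpha>)" by (cases p)
    with that have "0 < \<beta>" "\<beta> < \<alpha>" by (auto simp: P_def)
    show ?thesis unfolding p E_def prod.case
    proof (rule negligible_oscillating_increments[OF F \<open>0 < \<beta>\<close> \<open>\<beta> < \<alpha>\<close>])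
      show "bounded {x \<in> cball 0 (real R). big x \<alpha> \<and> small x \<beta>}"
        using bounded_cball by (rule bounded_subset) blast
    qed (auto simp: big_def small_def)
  qed
  have negZ: "negligible (Z R)" for R
    unfolding Z_def
  proof (rule negligible_unbounded_increments[OF F])
    show "bounded {x \<in> cball 0 (real R). \<forall>\<alpha>>0. big x \<alpha>}"
      using bounded_cball by (rule bounded_subset) blast
  qed (auto simp: big_def)
  have "negligible ((\<Union>p\<in>P. E p) \<union> (\<Union>R. Z R))"
    using \<open>countable P\<close> negE negZ
    by (intro negligible_Un negligible_countable_Union countable_image) auto
  moreover have "{x. \<not> F differentiable at x} \<subseteq> (\<Union>p\<in>P. E p) \<union> (\<Union>R. Z R)"
  proof
    fix x assume "x \<in> {x. \<not> F differentiable at x}"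
    then have nd: "\<not> F differentiable at x" by simp
    obtain R :: nat where R: "\<bar>x\<bar> \<le> real R" using real_arch_simple by blast
    show "x \<in> (\<Union>p\<in>P. E p) \<union> (\<Union>R. Z R)"
    proof (rule ccontr)
      assume n: "x \<notin> (\<Union>p\<in>P. E p) \<union> (\<Union>R. Z R)"
      then have "x \<notin> Z R" by blast
      then obtain \<alpha>0 where "0 < \<alpha>0" "\<not> big x \<alpha>0" using R by (auto simp: Z_def)
      then obtain \<delta>0 where \<delta>0: "\<delta>0 > 0"
        "\<And>c d. c < d \<Longrightarrow> x \<in> {c..d} \<Longrightarrow> d - c < \<delta>0 \<Longrightarrow> F d - F c \<le> \<alpha>0 * (d - c)"
        unfolding big_def by (meson not_less)
      have "F differentiable at x"
      proof (rule differentiable_if_increments_converge[OF F \<open>0 < \<alpha>0\<close> \<delta>0])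
        fix \<beta> \<alpha> :: real
        assume "\<beta> \<in> \<rat>" "\<alpha> \<in> \<rat>" "0 < \<beta>" "\<beta> < \<alpha>"
        then have "(R, \<beta>, \<alpha>) \<in> P" by (simp add: P_def)
        with n have "x \<notin> E (R, \<beta>, \<alpha>)" by blast
        then have "\<not> big x \<alpha> \<or> \<not> small x \<beta>" using R by (auto simp: E_def)
        then show "(\<exists>\<delta>>0. \<forall>c d. c < d \<longrightarrow> x \<in> {c..d} \<longrightarrow> d - c < \<delta> \<longrightarrow> F d - F c \<le> \<alpha> * (d - c)) \<or>
          (\<exists>\<delta>>0. \<forall>c d. c < d \<longrightarrow> x \<in> {c..d} \<longrightarrow> d - c < \<delta> \<longrightarrow> \<beta> * (d - c) \<le> F d - F c)"
          unfolding big_def small_def by (meson not_less)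
      qed
      with nd show False by contradiction
    qed
  qed
  ultimately show ?thesis by (rule negligible_subset)
qed

section \<open>Substitution by a monotone function\<close>

lemma DERIV_pos_strict_mono_at:
  fixes F :: "real \<Rightarrow> real"
  assumes F: "mono F" and D: "(F has_real_derivative l) (at x)" "0 < l" and "y \<noteq> x"
  shows "F y \<noteq> F x"
proof (cases "x < y")
  case True
  obtain d where d: "d > 0" "\<And>h. 0 < h \<Longrightarrow> h < d \<Longrightarrow> F x < F (x + h)"
    using DERIV_pos_inc_right[OF D] by auto
  define h where "h = min (d/2) (y - x)"
  have "0 < h" "h < d" "x + h \<le> y" using d(1) True by (auto simp: h_def min_def field_simps)
  with d(2)[of h] monoD[OF F, of "x + h" y] show ?thesis by simp
next
  case False
  with \<open>y \<noteq> x\<close> have "y < x" by simp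
  obtain d where d: "d > 0" "\<And>h. 0 < h \<Longrightarrow> h < d \<Longrightarrow> F (x - h) < F x"
    using DERIV_pos_inc_left[OF D] by auto
  define h where "h = min (d/2) (x - y)"
  have "0 < h" "h < d" "y \<le> x - h" using d(1) \<open>y < x\<close> by (auto simp: h_def min_def field_simps)
  with d(2)[of h] monoD[OF F, of y "x - h"] show ?thesis by simp
qed

text \<open>The term \<open>deriv F\<close> is unspecified at points of nondifferentiability. The limit of the
difference quotients along \<open>1 / (k + 1)\<close> is a Borel function on the whole line that agrees
with it elsewhere.\<close>

lemma mono_derivative_borel_version:
  fixes F :: "real \<Rightarrow> real"
  assumes F: "mono F"
  obtains D :: "real \<Rightarrow> real" where "D \<in> borel_measurable borel"
    "\<And>x l. (F has_real_derivative l) (at x) \<Longrightarrow> D x = l"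
proof -
  define D where "D x = lim (\<lambda>k. (F (x + 1 / real (Suc k)) - F x) / (1 / real (Suc k)))" for x
  have [measurable]: "F \<in> borel_measurable borel" using F by (rule borel_measurable_mono)
  have "D \<in> borel_measurable borel" unfolding D_def by measurable
  moreover have "D x = l" if "(F has_real_derivative l) (at x)" for x l
  proof -
    have "(\<lambda>h. (F (x + h) - F x) / h) \<midarrow>0\<rightarrow> l" using that by (simp add: DERIV_def)
    moreover have "filterlim (\<lambda>k. 1 / real (Suc k)) (at 0) sequentially"
      unfolding filterlim_at using lim_1_over_n[THEN LIMSEQ_Suc] by auto
    ultimately have "(\<lambda>k. (F (x + 1 / real (Suc k)) - F x) / (1 / real (Suc k))) \<longlonglongrightarrow> l"
      by (rule filterlim_compose)
    then show ?thesis unfolding D_def by (rule limI)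
  qed
  ultimately show thesis using that by blast
qed

text \<open>On the set where \<open>F\<close> is differentiable with positive derivative, \<open>F\<close> is injective, so the
change of variables formula identifies the left side with the measure of a subset of \<open>B\<close>.
Truncation makes the derivative bounded and the set bounded, as integrability requires.\<close>

lemma nn_integral_mono_derivative_le_emeasure:
  fixes F D :: "real \<Rightarrow> real"
  assumes F: "mono F" and D[measurable]: "D \<in> borel_measurable borel"
    and DF: "\<And>x l. (F has_real_derivative l) (at x) \<Longrightarrow> D x = l"
    and B[measurable]: "B \<in> sets borel"
  shows "(\<integral>\<^sup>+x. ennreal (D x) * indicator B (F x) \<partial>lebesgue) \<le> emeasure lborel B"
proof -
  have [measurable]: "F \<in> borel_measurable borel" using F by (rule borel_measurable_mono)
  define G where "G = {x. F differentiable at x}"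
  have "- G \<in> null_sets lebesgue"
    using negligible_mono_nondifferentiable[OF F] by (simp add: G_def negligible_iff_null_sets Compl_eq)
  then have G: "G \<in> sets lebesgue" and AE_G: "AE x in lebesgue. x \<in> G"
    using AE_not_in[of "- G" lebesgue] by (auto dest: null_setsD2 simp: Compl_in_sets_lebesgue)
  have DG: "(F has_real_derivative D x) (at x)" if "x \<in> G" for x
    using that DF unfolding G_def by (auto simp: real_differentiable_def)
  define S where "S k = G \<inter> {x. 0 < D x \<and> D x \<le> real k \<and> \<bar>x\<bar> \<le> real k \<and> F x \<in> B}" for k :: nat
  have "{x. 0 < D x \<and> D x \<le> real k \<and> \<bar>x\<bar> \<le> real k \<and> F x \<in> B} \<in> sets borel" for k
    by measurable
  then have S_leb: "S k \<in> sets lebesgue" for k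
    unfolding S_def using G by (intro sets.Int) auto
  have S_lm: "S k \<in> lmeasurable" for k
  proof (rule bounded_set_imp_lmeasurable[OF _ S_leb])
    show "bounded (S k)" by (rule boundedI[of _ "real k"]) (auto simp: S_def)
  qed
  have le: "(\<integral>\<^sup>+x. ennreal (D x) * indicator (S k) x \<partial>lborel) \<le> emeasure lborel B" for k
  proof -
    have "inj_on F (S k)"
    proof (rule inj_onI, rule ccontr)
      fix x y assume xy: "x \<in> S k" "y \<in> S k" "F x = F y" "x \<noteq> y"
      then have "F y \<noteq> F x"
        using DERIV_pos_strict_mono_at[OF F DG[of x], of y] by (auto simp: S_def)
      with xy show False by simp
    qed
    moreover have "(F has_field_derivative D x) (at x within S k)" if "x \<in> S k" for x
      using DG[of x] that by (auto simp: S_def intro: has_field_derivative_at_within)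
    moreover have ai: "(\<lambda>x. \<bar>D x\<bar> * 1) absolutely_integrable_on S k"
    proof (rule measurable_bounded_by_integrable_imp_absolutely_integrable[OF _ S_leb])
      show "(\<lambda>x. real k) integrable_on S k" using S_lm by (rule integrable_on_const)
      have "(\<lambda>x. \<bar>D x\<bar> * 1) \<in> borel_measurable lborel" by measurable
      then show "(\<lambda>x. \<bar>D x\<bar> * 1) \<in> borel_measurable (lebesgue_on (S k))"
        by (intro measurable_restrict_space1 measurable_completion)
    qed (auto simp: S_def)
    ultimately have im: "(\<lambda>x. 1::real) absolutely_integrable_on (F ` S k)"
      "integral (F ` S k) (\<lambda>x. 1::real) = integral (S k) (\<lambda>x. \<bar>D x\<bar> * 1)"
      using has_absolute_integral_change_of_variables_1'[of "S k" F D "\<lambda>x. 1" "integral (S k) (\<lambda>x. \<bar>D x\<bar> * 1)"] S_leb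
      by auto
    then have lm: "F ` S k \<in> lmeasurable"
      using lmeasurable_iff_integrable_on set_lebesgue_integral_eq_integral(1) by blast
    have "((\<lambda>x. \<bar>D x\<bar> * 1) has_integral integral (S k) (\<lambda>x. \<bar>D x\<bar> * 1)) (S k)"
      using ai set_lebesgue_integral_eq_integral(1) integrable_integral by blast
    then have "(\<integral>\<^sup>+x. ennreal (\<bar>D x\<bar> * 1) * indicator (S k) x \<partial>lborel) = ennreal (integral (S k) (\<lambda>x. \<bar>D x\<bar> * 1))"
      by (rule nn_integral_has_integral_lebesgue'[rotated]) auto
    also have "\<dots> = ennreal (measure lebesgue (F ` S k))"
      using im(2) lm by (simp add: lmeasure_integral)
    also have "\<dots> = emeasure lebesgue (F ` S k)" using lm by (simp add: emeasure_eq_measure2)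
    also have "\<dots> \<le> emeasure lebesgue B" by (intro emeasure_mono) (auto simp: S_def)
    also have "(\<integral>\<^sup>+x. ennreal (\<bar>D x\<bar> * 1) * indicator (S k) x \<partial>lborel)
        = (\<integral>\<^sup>+x. ennreal (D x) * indicator (S k) x \<partial>lborel)"
      by (intro nn_integral_cong) (auto simp: S_def indicator_def)
    finally show ?thesis by simp
  qed
  have S_mono: "indicator (S k) x \<le> (indicator (S l) x :: ennreal)" if "k \<le> l" for k l x
    using that by (auto simp: S_def indicator_def intro: order_trans)
  have "(\<integral>\<^sup>+x. ennreal (D x) * indicator B (F x) \<partial>lebesgue)
      \<le> (\<integral>\<^sup>+x. (SUP k. ennreal (D x) * indicator (S k) x) \<partial>lebesgue)"
  proof (intro nn_integral_mono_AE, use AE_G in eventually_elim)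
    case (elim x)
    show ?case
    proof (cases "0 < D x \<and> F x \<in> B")
      case True
      obtain k :: nat where "max (D x) \<bar>x\<bar> \<le> real k" using real_arch_simple by blast
      with True elim have "x \<in> S k" by (auto simp: S_def)
      then show ?thesis using True by (intro SUP_upper2[of k]) auto
    next
      case False
      then have "ennreal (D x) * indicator B (F x) = 0"
        by (auto simp: indicator_def ennreal_neg not_less)
      then show ?thesis by (simp only: zero_le)
    qed
  qed
  also have "\<dots> = (SUP k. \<integral>\<^sup>+x. ennreal (D x) * indicator (S k) x \<partial>lebesgue)"
  proof (rule nn_integral_monotone_convergence_SUP)
    show "incseq (\<lambda>k x. ennreal (D x) * indicator (S k) x)"
      using S_mono by (auto simp: incseq_def le_fun_def intro!: mult_left_mono)
    have "(\<lambda>x. ennreal (D x)) \<in> borel_measurable lborel" by measurable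
    then show "(\<lambda>x. ennreal (D x) * indicator (S k) x) \<in> borel_measurable lebesgue" for k
      using S_leb by (intro borel_measurable_times_ennreal borel_measurable_indicator measurable_completion)
  qed
  also have "\<dots> \<le> emeasure lborel B"
    using le by (intro SUP_least) (simp add: nn_integral_completion)
  finally show ?thesis .
qed

text \<open>Only an inequality, since \<open>F\<close> may jump and may have a singular part.\<close>

theorem nn_integral_mono_substitution_le:
  fixes F :: "real \<Rightarrow> real" and g :: "real \<Rightarrow> ennreal"
  assumes F: "mono F" and g[measurable]: "g \<in> borel_measurable borel"
  shows "(\<integral>\<^sup>+x. g (F x) * ennreal (deriv F x) \<partial>lebesgue) \<le> (\<integral>\<^sup>+y. g y \<partial>lborel)"
proof -
  have [measurable]: "F \<in> borel_measurable borel" using F by (rule borel_measurable_mono)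
  obtain D where D[measurable]: "D \<in> borel_measurable borel"
    and DF: "\<And>x l. (F has_real_derivative l) (at x) \<Longrightarrow> D x = l"
    using mono_derivative_borel_version[OF F] by blast
  have "AE x in lebesgue. F differentiable at x"
    using negligible_mono_nondifferentiable[OF F] AE_not_in[of "{x. \<not> F differentiable at x}" lebesgue]
    by (simp add: negligible_iff_null_sets)
  then have "AE x in lebesgue. deriv F x = D x"
  proof eventually_elim
    case (elim x)
    then show ?case using DF[of "deriv F x" x] by (simp add: DERIV_deriv_iff_real_differentiable)
  qed
  then have "(\<integral>\<^sup>+x. g (F x) * ennreal (deriv F x) \<partial>lebesgue) = (\<integral>\<^sup>+x. ennreal (D x) * g (F x) \<partial>lebesgue)"
    by (intro nn_integral_cong_AE) (auto simp: mult.commute elim!: eventually_mono)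
  also have "\<dots> = (\<integral>\<^sup>+x. ennreal (D x) * g (F x) \<partial>lborel)" by (simp add: nn_integral_completion)
  also have "\<dots> = (\<integral>\<^sup>+y. g y \<partial>distr (density lborel (\<lambda>x. ennreal (D x))) borel F)"
    by (simp add: nn_integral_distr nn_integral_density)
  also have "\<dots> \<le> (\<integral>\<^sup>+y. g y \<partial>lborel)"
  proof (intro nn_integral_mono_measure)
    show "distr (density lborel (\<lambda>x. ennreal (D x))) borel F \<le> lborel"
    proof (subst le_measure, simp, intro ballI)
      fix B assume "B \<in> sets (distr (density lborel (\<lambda>x. ennreal (D x))) borel F)"
      then have [measurable]: "B \<in> sets borel" by simp
      have "emeasure (distr (density lborel (\<lambda>x. ennreal (D x))) borel F) B
          = (\<integral>\<^sup>+x. ennreal (D x) * indicator (F -` B) x \<partial>lborel)"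
        using measurable_sets[of F borel borel B] by (simp add: emeasure_distr emeasure_density)
      also have "\<dots> = (\<integral>\<^sup>+x. ennreal (D x) * indicator B (F x) \<partial>lebesgue)"
        by (simp add: nn_integral_completion indicator_vimage)
      also have "\<dots> \<le> emeasure lborel B"
        by (rule nn_integral_mono_derivative_le_emeasure[OF F D DF]) auto
      finally show "emeasure (distr (density lborel (\<lambda>x. ennreal (D x))) borel F) B \<le> emeasure lborel B" .
    qed
  qed simp
  finally show ?thesis .
qed

section \<open>The Banach indicatrix\<close>

lemma real_set_diameter_cover:
  fixes X :: "real set" and w :: ennreal
  assumes "\<And>x y. x \<in> X \<Longrightarrow> y \<in> X \<Longrightarrow> ennreal \<bar>x - y\<bar> \<le> w"
  obtains Y where "Y \<in> sets borel" "X \<subseteq> Y" "emeasure lborel Y \<le> w"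
proof (cases "X = {} \<or> w = \<infinity>")
  case True
  then show thesis
  proof
    assume "X = {}"
    then show thesis by (intro that[of "{}"]) auto
  next
    assume "w = \<infinity>"
    then show thesis by (intro that[of UNIV]) auto
  qed
next
  case False
  then obtain r where r: "w = ennreal r" "0 \<le> r" and "X \<noteq> {}" by (cases w) auto
  have d: "\<bar>x - y\<bar> \<le> r" if "x \<in> X" "y \<in> X" for x y
    using assms[OF that] r by simp
  obtain z where z: "z \<in> X" using \<open>X \<noteq> {}\<close> by blast
  have lb: "Sup X - r \<le> x" if "x \<in> X" for x
  proof -
    have "Sup X \<le> x + r" using d[OF _ that] by (intro cSup_least \<open>X \<noteq> {}\<close>) (auto simp: abs_le_iff algebra_simps)
    then show ?thesis by simp
  qed
  have ub: "x \<le> Sup X" if "x \<in> X" for x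
    using d[OF _ z] by (intro cSup_upper that bdd_aboveI[of _ "z + r"]) (auto simp: abs_le_iff algebra_simps)
  show thesis
    by (rule that[of "{Sup X - r..Sup X}"]) (use lb ub r in auto)
qed

text \<open>The function \<open>W\<close> plays the role of an upper gradient of \<open>U\<close>. On each component \<open>C\<close> of \<open>E\<close>
the oscillation of \<open>U\<close> is at most the integral of \<open>W\<close> over \<open>C\<close>. The conclusion speaks of a Borel
cover because \<open>U ` E\<close> itself need not be measurable here.\<close>

lemma emeasure_image_open_cover:
  fixes U :: "real \<Rightarrow> real" and W :: "real \<Rightarrow> ennreal"
  assumes W[measurable]: "W \<in> borel_measurable borel"
    and grad: "\<And>x y. x \<le> y \<Longrightarrow> ennreal \<bar>U y - U x\<bar> \<le> (\<integral>\<^sup>+t\<in>{x..y}. W t \<partial>lborel)"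
    and "open E"
  obtains Y where "Y \<in> sets borel" "U ` E \<subseteq> Y" "emeasure lborel Y \<le> (\<integral>\<^sup>+t\<in>E. W t \<partial>lborel)"
proof -
  define \<C> where "\<C> = components E"
  have opn: "open C" if "C \<in> \<C>" for C
    using that \<open>open E\<close> open_components unfolding \<C>_def by blast
  have disj: "pairwise disjnt \<C>"
    using pairwise_disjoint_components[of E] by (simp add: \<C>_def disjnt_def pairwise_def)
  then have cnt: "countable \<C>" using opn by (intro countable_disjoint_open_subsets)
  have "\<exists>Y. Y \<in> sets borel \<and> U ` C \<subseteq> Y \<and> emeasure lborel Y \<le> (\<integral>\<^sup>+t\<in>C. W t \<partial>lborel)" if C: "C \<in> \<C>" for C
  proof -
    have "connected C" using C in_components_connected unfolding \<C>_def by blast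
    then have "is_interval C" by (simp add: is_interval_connected_1)
    then have int: "{x..y} \<subseteq> C" if "x \<in> C" "y \<in> C" for x y
      using that unfolding is_interval_1 by (meson atLeastAtMost_iff subsetI)
    have le: "ennreal \<bar>U y - U x\<bar> \<le> (\<integral>\<^sup>+t\<in>C. W t \<partial>lborel)" if "x \<in> C" "y \<in> C" "x \<le> y" for x y
    proof -
      have "ennreal \<bar>U y - U x\<bar> \<le> (\<integral>\<^sup>+t\<in>{x..y}. W t \<partial>lborel)" using grad that by blast
      also have "\<dots> \<le> (\<integral>\<^sup>+t\<in>C. W t \<partial>lborel)"
        using int[OF that(1,2)] by (intro nn_integral_mono) (auto simp: indicator_def)
      finally show ?thesis .
    qed
    have le': "ennreal \<bar>u - v\<bar> \<le> (\<integral>\<^sup>+t\<in>C. W t \<partial>lborel)" if uv: "u \<in> U ` C" "v \<in> U ` C" for u v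
    proof -
      obtain x y where xy: "x \<in> C" "u = U x" "y \<in> C" "v = U y" using uv by blast
      show ?thesis
        using le[of x y] le[of y x] xy by (cases "x \<le> y") (auto simp: abs_minus_commute)
    qed
    show ?thesis by (rule real_set_diameter_cover[OF le']) blast+
  qed
  then obtain Y where Y: "\<And>C. C \<in> \<C> \<Longrightarrow> Y C \<in> sets borel" "\<And>C. C \<in> \<C> \<Longrightarrow> U ` C \<subseteq> Y C"
    "\<And>C. C \<in> \<C> \<Longrightarrow> emeasure lborel (Y C) \<le> (\<integral>\<^sup>+t\<in>C. W t \<partial>lborel)"
    by metis
  show thesis
  proof
    show mY: "(\<Union>C\<in>\<C>. Y C) \<in> sets borel" using cnt Y(1) by (intro sets.countable_UN') auto
    show "U ` E \<subseteq> (\<Union>C\<in>\<C>. Y C)"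
    proof
      fix u assume "u \<in> U ` E"
      then obtain x where "x \<in> E" "u = U x" by blast
      moreover have "E = \<Union>\<C>" by (simp add: \<C>_def)
      ultimately show "u \<in> (\<Union>C\<in>\<C>. Y C)" using Y(2) by blast
    qed
    have "emeasure lborel (\<Union>C\<in>\<C>. Y C) = (\<integral>\<^sup>+y. indicator (\<Union>C\<in>\<C>. Y C) y \<partial>lborel)"
      using mY by (subst nn_integral_indicator) auto
    also have "\<dots> \<le> (\<integral>\<^sup>+y. (\<integral>\<^sup>+C. indicator (Y C) y \<partial>count_space \<C>) \<partial>lborel)"
    proof (intro nn_integral_mono)
      fix y
      show "indicator (\<Union>C\<in>\<C>. Y C) y \<le> (\<integral>\<^sup>+C. indicator (Y C) y \<partial>count_space \<C> :: ennreal)"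
      proof (cases "y \<in> (\<Union>C\<in>\<C>. Y C)")
        case True
        then obtain C where "C \<in> \<C>" "y \<in> Y C" by blast
        then show ?thesis using nn_integral_ge_point[of C \<C> "\<lambda>C. indicator (Y C) y"] True by simp
      qed simp
    qed
    also have "\<dots> = (\<integral>\<^sup>+C. (\<integral>\<^sup>+y. indicator (Y C) y \<partial>lborel) \<partial>count_space \<C>)"
      using cnt Y(1) by (intro nn_integral_count_space_nn_integral) auto
    also have "\<dots> = (\<integral>\<^sup>+C. emeasure lborel (Y C) \<partial>count_space \<C>)"
      using Y(1) by (intro nn_integral_cong) simp
    also have "\<dots> \<le> (\<integral>\<^sup>+C. (\<integral>\<^sup>+t\<in>C. W t \<partial>lborel) \<partial>count_space \<C>)"
      using Y(3) by (intro nn_integral_mono) simp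
    also have "\<dots> = (\<integral>\<^sup>+C. emeasure (density lborel W) C \<partial>count_space \<C>)"
      using opn by (intro nn_integral_cong) (simp add: emeasure_density)
    also have "\<dots> = emeasure (density lborel W) (\<Union>C\<in>\<C>. C)"
      using cnt opn disj by (intro emeasure_UN_countable[symmetric])
        (auto simp: disjoint_family_on_def pairwise_def disjnt_def)
    also have "(\<Union>C\<in>\<C>. C) = E" by (simp add: \<C>_def)
    also have "emeasure (density lborel W) E = (\<integral>\<^sup>+t\<in>E. W t \<partial>lborel)"
      using \<open>open E\<close> by (simp add: emeasure_density)
    finally show "emeasure lborel (\<Union>C\<in>\<C>. Y C) \<le> (\<integral>\<^sup>+t\<in>E. W t \<partial>lborel)" .
  qed
qed

lemma emeasure_image_le_nn_integral:
  fixes U :: "real \<Rightarrow> real" and W :: "real \<Rightarrow> ennreal"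
  assumes W[measurable]: "W \<in> borel_measurable borel" and fin: "(\<integral>\<^sup>+t. W t \<partial>lborel) < \<infinity>"
    and grad: "\<And>x y. x \<le> y \<Longrightarrow> ennreal \<bar>U y - U x\<bar> \<le> (\<integral>\<^sup>+t\<in>{x..y}. W t \<partial>lborel)"
    and E[measurable]: "E \<in> sets borel"
  shows "emeasure lborel (U ` E) \<le> (\<integral>\<^sup>+t\<in>E. W t \<partial>lborel)"
proof -
  have d: "emeasure (density lborel W) A = (\<integral>\<^sup>+t\<in>A. W t \<partial>lborel)" if "A \<in> sets borel" for A
    using that by (simp add: emeasure_density)
  have "emeasure (density lborel W) E = (INF G \<in> {G. E \<subseteq> G \<and> open G}. emeasure (density lborel W) G)"
    using fin by (intro outer_regular) (auto simp: d)
  moreover have "emeasure lborel (U ` E) \<le> \<dots>"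
  proof (rule INF_greatest)
    fix G assume "G \<in> {G. E \<subseteq> G \<and> open G}"
    then have G: "E \<subseteq> G" "open G" by auto
    obtain Y where "Y \<in> sets borel" "U ` G \<subseteq> Y" "emeasure lborel Y \<le> (\<integral>\<^sup>+t\<in>G. W t \<partial>lborel)"
      using emeasure_image_open_cover[OF W grad G(2)] by blast
    moreover have "emeasure lborel (U ` E) \<le> emeasure lborel Y"
      using calculation G(1) by (intro emeasure_mono) auto
    ultimately show "emeasure lborel (U ` E) \<le> emeasure (density lborel W) G"
      using G(2) by (simp add: d)
  qed
  ultimately show ?thesis by (simp add: d)
qed

text \<open>One half of Banach's indicatrix formula. Cutting \<open>[a, b]\<close> into pieces \<open>J k i\<close> of length at most
\<open>1 / k\<close>, the number of pieces whose image contains \<open>y\<close> is eventually at least the size of any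
given finite part of the level set of \<open>y\<close>; Fatou's lemma gives the bound for the lower limit \<open>N\<close>. Only
a Borel majorant \<open>N\<close> of the level count is needed, so the measurability of the
level count itself is not discussed.\<close>

theorem level_count_nn_integral_le:
  fixes U :: "real \<Rightarrow> real" and W :: "real \<Rightarrow> ennreal"
  assumes W[measurable]: "W \<in> borel_measurable borel" and fin: "(\<integral>\<^sup>+t. W t \<partial>lborel) < \<infinity>"
    and cont: "continuous_on UNIV U"
    and grad: "\<And>x y. x \<le> y \<Longrightarrow> ennreal \<bar>U y - U x\<bar> \<le> (\<integral>\<^sup>+t\<in>{x..y}. W t \<partial>lborel)"
  obtains N :: "real \<Rightarrow> ennreal" where "N \<in> borel_measurable borel"
    "\<And>y. level_count a b U y \<le> N y"
    "\<And>g. g \<in> borel_measurable borel \<Longrightarrow>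
       (\<integral>\<^sup>+y. g y * N y \<partial>lborel) \<le> (\<integral>\<^sup>+x\<in>{a..b}. g (U x) * W x \<partial>lborel)"
proof -
  have U[measurable]: "U \<in> borel_measurable borel" using cont by (rule borel_measurable_continuous_onI)
  define J where "J k i = {x \<in> {a..b}. \<lfloor>real k * x\<rfloor> = i}" for k :: nat and i :: int
  have J[measurable]: "J k i \<in> sets borel" for k i
    unfolding J_def by measurable
  have UJ[measurable]: "U ` J k i \<in> sets borel" for k i
  proof -
    have "is_interval (J k i)"
      unfolding is_interval_1
    proof (intro ballI allI impI)
      fix x y z assume xy: "x \<in> J k i" "y \<in> J k i" and z: "x \<le> z \<and> z \<le> y"
      have "\<lfloor>real k * x\<rfloor> \<le> \<lfloor>real k * z\<rfloor>" "\<lfloor>real k * z\<rfloor> \<le> \<lfloor>real k * y\<rfloor>"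
        using z by (auto intro!: floor_mono mult_left_mono)
      with xy z show "z \<in> J k i" by (auto simp: J_def)
    qed
    then have "connected (J k i)" by (simp add: is_interval_connected_1)
    then have "connected (U ` J k i)"
      using cont continuous_on_subset by (intro connected_continuous_image) auto
    then have "is_interval (U ` J k i)" by (simp add: is_interval_connected_1)
    then show ?thesis by (rule real_interval_borel_measurable)
  qed
  define n where "n k y = (\<integral>\<^sup>+i. indicator (U ` J k i) y \<partial>count_space UNIV)" for k y
  have n[measurable]: "n k \<in> borel_measurable borel" for k
  proof -
    have "n k = (\<lambda>y. \<Sum>m. indicator (U ` J k (int_decode m)) y)"
      using nn_integral_bij_count_space[OF bij_int_decode, of "\<lambda>i. indicator (U ` J k i) y" for y]
      by (auto simp: n_def nn_integral_count_space_nat)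
    moreover have "(\<lambda>y. \<Sum>m. indicator (U ` J k (int_decode m)) y :: ennreal) \<in> borel_measurable borel"
      by measurable
    ultimately show ?thesis by simp
  qed
  define N where "N y = liminf (\<lambda>k. n k y)" for y
  have N[measurable]: "N \<in> borel_measurable borel" unfolding N_def by measurable
  have n_le: "(\<integral>\<^sup>+y. n k y * indicator B y \<partial>lborel)
      \<le> (\<integral>\<^sup>+x. W x * indicator {a..b} x * indicator B (U x) \<partial>lborel)" if B[measurable]: "B \<in> sets borel" for k B
  proof -
    have "(\<integral>\<^sup>+y. n k y * indicator B y \<partial>lborel)
        = (\<integral>\<^sup>+y. (\<integral>\<^sup>+i. indicator (U ` J k i) y * indicator B y \<partial>count_space UNIV) \<partial>lborel)"
      by (simp add: n_def nn_integral_multc)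
    also have "\<dots> = (\<integral>\<^sup>+i. (\<integral>\<^sup>+y. indicator (U ` J k i) y * indicator B y \<partial>lborel) \<partial>count_space UNIV)"
      by (intro nn_integral_count_space_nn_integral) auto
    also have "\<dots> \<le> (\<integral>\<^sup>+i. (\<integral>\<^sup>+x. W x * indicator (J k i \<inter> U -` B) x \<partial>lborel) \<partial>count_space UNIV)"
    proof (rule nn_integral_mono)
      fix i
      have "(\<integral>\<^sup>+y. indicator (U ` J k i) y * indicator B y \<partial>lborel) = emeasure lborel (U ` J k i \<inter> B)"
        by (simp add: indicator_inter_arith[symmetric])
      also have "\<dots> = emeasure lborel (U ` (J k i \<inter> U -` B))"
        by (rule arg_cong[where f = "emeasure lborel"]) blast
      also have "\<dots> \<le> (\<integral>\<^sup>+x. W x * indicator (J k i \<inter> U -` B) x \<partial>lborel)"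
        using measurable_sets[OF U B] by (intro emeasure_image_le_nn_integral[OF W fin grad]) auto
      finally show "(\<integral>\<^sup>+y. indicator (U ` J k i) y * indicator B y \<partial>lborel)
        \<le> (\<integral>\<^sup>+x. W x * indicator (J k i \<inter> U -` B) x \<partial>lborel)" .
    qed
    also have "\<dots> = (\<integral>\<^sup>+x. (\<integral>\<^sup>+i. W x * indicator (J k i \<inter> U -` B) x \<partial>count_space UNIV) \<partial>lborel)"
      using measurable_sets[OF U B] by (intro nn_integral_count_space_nn_integral[symmetric]) auto
    also have "\<dots> = (\<integral>\<^sup>+x. W x * indicator {a..b} x * indicator B (U x) \<partial>lborel)"
    proof (rule nn_integral_cong)
      fix x
      have "(\<integral>\<^sup>+i. W x * indicator (J k i \<inter> U -` B) x \<partial>count_space UNIV)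
          = (\<integral>\<^sup>+i. (W x * indicator {a..b} x * indicator B (U x)) * indicator {\<lfloor>real k * x\<rfloor>} i \<partial>count_space UNIV)"
        by (intro nn_integral_cong) (auto simp: J_def indicator_def)
      also have "\<dots> = W x * indicator {a..b} x * indicator B (U x)"
        by (simp add: nn_integral_cmult)
      finally show "(\<integral>\<^sup>+i. W x * indicator (J k i \<inter> U -` B) x \<partial>count_space UNIV)
          = W x * indicator {a..b} x * indicator B (U x)" .
    qed
    finally show ?thesis .
  qed
  have N_le: "(\<integral>\<^sup>+y. N y * indicator B y \<partial>lborel)
      \<le> (\<integral>\<^sup>+x. W x * indicator {a..b} x * indicator B (U x) \<partial>lborel)" if B[measurable]: "B \<in> sets borel" for B
  proof -
    have "(\<integral>\<^sup>+y. N y * indicator B y \<partial>lborel) = (\<integral>\<^sup>+y. liminf (\<lambda>k. n k y * indicator B y) \<partial>lborel)"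
      by (intro nn_integral_cong) (simp add: N_def indicator_def Liminf_const)
    also have "\<dots> \<le> liminf (\<lambda>k. \<integral>\<^sup>+y. n k y * indicator B y \<partial>lborel)"
      by (intro nn_integral_liminf) measurable
    also have "\<dots> \<le> liminf (\<lambda>k::nat. \<integral>\<^sup>+x. W x * indicator {a..b} x * indicator B (U x) \<partial>lborel)"
      using n_le[OF B] by (intro Liminf_mono) simp
    finally show ?thesis by (simp add: Liminf_const)
  qed
  have card_le: "of_nat (card F) \<le> N y" if F: "finite F" "F \<subseteq> {x \<in> {a..b}. U x = y}" for F y
  proof -
    have sep: "\<forall>\<^sub>F k in sequentially. \<lfloor>real k * x\<rfloor> \<noteq> \<lfloor>real k * z\<rfloor>" if "x < z" for x z :: real
    proof -
      obtain K :: nat where K: "1 / (z - x) \<le> real K" using real_arch_simple by blast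
      have "\<lfloor>real k * x\<rfloor> \<noteq> \<lfloor>real k * z\<rfloor>" if "K \<le> k" for k
      proof -
        have "1 / (z - x) \<le> real k" using K that by linarith
        then have "real k * x + 1 \<le> real k * z" using \<open>x < z\<close> by (simp add: field_simps)
        then show ?thesis by linarith
      qed
      then show ?thesis by (auto simp: eventually_sequentially)
    qed
    have "\<forall>\<^sub>F k in sequentially. x \<noteq> z \<longrightarrow> \<lfloor>real k * x\<rfloor> \<noteq> \<lfloor>real k * z\<rfloor>" for x z :: real
      using sep[of x z] sep[of z x]
      by (cases x z rule: linorder_cases) (auto elim!: eventually_mono)
    then have "\<forall>\<^sub>F k in sequentially. \<forall>x\<in>F. \<forall>z\<in>F. x \<noteq> z \<longrightarrow> \<lfloor>real k * x\<rfloor> \<noteq> \<lfloor>real k * z\<rfloor>"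
      using F(1) by (intro eventually_ball_finite ballI)
    then have "\<forall>\<^sub>F k in sequentially. of_nat (card F) \<le> n k y"
    proof eventually_elim
      case (elim k)
      define I where "I = (\<lambda>x. \<lfloor>real k * x\<rfloor>) ` F"
      have "inj_on (\<lambda>x. \<lfloor>real k * x\<rfloor>) F" using elim by (auto simp: inj_on_def)
      then have "of_nat (card F) = (of_nat (card I) :: ennreal)" by (simp add: I_def card_image)
      also have "\<dots> = emeasure (count_space UNIV) I"
        using F(1) by (simp add: I_def)
      also have "\<dots> = (\<integral>\<^sup>+i. indicator I i \<partial>count_space UNIV)" by simp
      also have "\<dots> \<le> n k y"
        unfolding n_def
      proof (intro nn_integral_mono)
        fix i
        have "y \<in> U ` J k i" if "i \<in> I" using that F(2) by (auto simp: I_def J_def)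
        then show "indicator I i \<le> (indicator (U ` J k i) y :: ennreal)" by (auto simp: indicator_def)
      qed
      finally show ?case .
    qed
    then show ?thesis unfolding N_def by (rule Liminf_bounded)
  qed
  have count_le: "level_count a b U y \<le> N y" for y
  proof (cases "finite {x \<in> {a..b}. U x = y}")
    case True
    then have "level_count a b U y = of_nat (card {x \<in> {a..b}. U x = y})"
      unfolding level_count_def by (intro emeasure_count_space_finite) auto
    then show ?thesis using card_le[OF True, of y] by simp
  next
    case False
    have "of_nat m \<le> N y" for m
      using infinite_arbitrarily_large[OF False, of m] card_le[of _ y] by metis
    then have "N y = top" by (metis ennreal_Ex_less_of_nat leD top.not_eq_extremum)
    then show ?thesis by simp
  qed
  have "(\<integral>\<^sup>+y. g y * N y \<partial>lborel) \<le> (\<integral>\<^sup>+x\<in>{a..b}. g (U x) * W x \<partial>lborel)"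
    if g[measurable]: "g \<in> borel_measurable borel" for g
  proof -
    define M where "M = distr (density lborel (\<lambda>x. W x * indicator {a..b} x)) borel U"
    have [simp]: "sets M = sets borel" by (simp add: M_def)
    have "(\<integral>\<^sup>+y. g y * N y \<partial>lborel) = (\<integral>\<^sup>+y. g y \<partial>density lborel N)"
      by (simp add: nn_integral_density mult.commute)
    also have "\<dots> \<le> (\<integral>\<^sup>+y. g y \<partial>M)"
    proof (intro nn_integral_mono_measure)
      show "density lborel N \<le> M"
      proof (subst le_measure, simp, intro ballI)
        fix B assume "B \<in> sets (density lborel N)"
        then have B[measurable]: "B \<in> sets borel" by simp
        have "emeasure M B = (\<integral>\<^sup>+x. W x * indicator {a..b} x * indicator B (U x) \<partial>lborel)"
          using measurable_sets[OF U B] by (simp add: M_def emeasure_distr emeasure_density indicator_vimage)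
        then show "emeasure (density lborel N) B \<le> emeasure M B"
          using N_le[OF B] by (simp add: emeasure_density)
      qed
    qed simp
    also have "\<dots> = (\<integral>\<^sup>+x. W x * indicator {a..b} x * g (U x) \<partial>lborel)"
      by (simp add: M_def nn_integral_distr nn_integral_density)
    finally show ?thesis by (simp add: mult_ac)
  qed
  then show thesis using that[OF N count_le] by blast
qed

section \<open>Increments of a function with integrable weak derivative\<close>

lemma has_real_derivative_max0_square:
  "((\<lambda>t::real. (max 0 t)\<^sup>2) has_real_derivative 2 * max 0 t) (at t)"
  unfolding has_field_derivative_def has_derivative_at_alt
proof (intro conjI allI impI)
  show "bounded_linear ((*) (2 * max 0 t))" by (rule bounded_linear_mult_right)
  fix e :: real assume "0 < e"
  have key: "\<bar>(max 0 y)\<^sup>2 - (max 0 t)\<^sup>2 - 2 * max 0 t * (y - t)\<bar> \<le> (y - t)\<^sup>2" for y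
  proof -
    have "(max 0 y)\<^sup>2 - (max 0 t)\<^sup>2 - 2 * max 0 t * (y - t) \<le> (y - t)\<^sup>2
      \<and> 0 \<le> (max 0 y)\<^sup>2 - (max 0 t)\<^sup>2 - 2 * max 0 t * (y - t)"
    proof (cases "0 \<le> t"; cases "0 \<le> y")
      assume "0 \<le> t" "0 \<le> y"
      moreover have "y\<^sup>2 - t\<^sup>2 - 2 * t * (y - t) = (y - t)\<^sup>2" by (simp add: power2_eq_square algebra_simps)
      ultimately show ?thesis by simp
    next
      assume ty: "0 \<le> t" "\<not> 0 \<le> y"
      then have e: "(max 0 y)\<^sup>2 - (max 0 t)\<^sup>2 - 2 * max 0 t * (y - t) = t\<^sup>2 - 2 * (t * y)"
        by (simp add: max_def power2_eq_square algebra_simps)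
      have "t * y \<le> 0" using ty by (simp add: mult_nonneg_nonpos)
      then have "2 * (t * y) \<le> t\<^sup>2" using zero_le_power2[of t] by linarith
      then show ?thesis unfolding e by (simp add: power2_diff)
    next
      assume "\<not> 0 \<le> t" "0 \<le> y"
      moreover have "2 * (t * y) \<le> t\<^sup>2"
        using calculation mult_nonpos_nonneg[of t y] zero_le_power2[of t] by linarith
      ultimately show ?thesis by (simp add: power2_diff max_def algebra_simps)
    next
      assume "\<not> 0 \<le> t" "\<not> 0 \<le> y"
      then show ?thesis by simp
    qed
    then show ?thesis by linarith
  qed
  show "\<exists>d>0. \<forall>y. norm (y - t) < d \<longrightarrow>
      norm ((max 0 y)\<^sup>2 - (max 0 t)\<^sup>2 - 2 * max 0 t * (y - t)) \<le> e * norm (y - t)"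
  proof (intro exI[of _ e] conjI allI impI)
    fix y assume "norm (y - t) < e"
    then have "(y - t)\<^sup>2 \<le> e * norm (y - t)"
      by (simp add: power2_eq_square abs_mult_self_eq[symmetric, of "y - t"] mult_right_mono del: abs_mult_self_eq)
    with key[of y] show "norm ((max 0 y)\<^sup>2 - (max 0 t)\<^sup>2 - 2 * max 0 t * (y - t)) \<le> e * norm (y - t)" by simp
  qed fact
qed

text \<open>A continuously differentiable step from \<open>0\<close> to \<open>1\<close> across \<open>[0, 1]\<close>, written as a spline in
the squares of positive parts so that no case distinction is needed to differentiate it.\<close>

definition smooth_step :: "real \<Rightarrow> real" where
  "smooth_step t = 2 * (max 0 t)\<^sup>2 - 4 * (max 0 (t - 1/2))\<^sup>2 + 2 * (max 0 (t - 1))\<^sup>2"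

text \<open>The derivative of \<open>smooth_step\<close>: the tent function on \<open>[0, 1]\<close> of integral \<open>1\<close>.\<close>

definition hat :: "real \<Rightarrow> real" where
  "hat t = 4 * max 0 t - 8 * max 0 (t - 1/2) + 4 * max 0 (t - 1)"

lemma smooth_step_deriv: "(smooth_step has_real_derivative hat t) (at t)"
  unfolding smooth_step_def[abs_def] hat_def
  by (rule derivative_eq_intros DERIV_chain2[OF has_real_derivative_max0_square] refl)+ simp

lemma smooth_step_0: "t \<le> 0 \<Longrightarrow> smooth_step t = 0"
  by (simp add: smooth_step_def)

lemma smooth_step_1: "1 \<le> t \<Longrightarrow> smooth_step t = 1"
  by (simp add: smooth_step_def power2_eq_square algebra_simps)

lemma hat_nonneg: "0 \<le> hat t"
  by (auto simp: hat_def max_def)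

lemma hat_0: "t \<notin> {0..1} \<Longrightarrow> hat t = 0"
  by (auto simp: hat_def max_def)

lemma continuous_on_hat: "continuous_on A hat"
  unfolding hat_def[abs_def] by (intro continuous_intros)

lemma smooth_step_bounds: "smooth_step t \<in> {0..1}"
proof -
  have mono: "smooth_step x \<le> smooth_step y" if "x \<le> y" for x y
    using that by (rule DERIV_nonneg_imp_nondecreasing) (use smooth_step_deriv hat_nonneg in blast)
  show ?thesis
    using mono[of "min t 0" t] mono[of t "max t 1"] smooth_step_0[of "min t 0"] smooth_step_1[of "max t 1"] by auto
qed

lemma smooth_step_rescale_deriv:
  "((\<lambda>t. smooth_step ((t - x) / \<epsilon>)) has_real_derivative hat ((t - x) / \<epsilon>) / \<epsilon>) (at t)"
proof (cases "\<epsilon> = 0")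
  case False
  then have "((\<lambda>t. (t - x) / \<epsilon>) has_real_derivative 1 / \<epsilon>) (at t)"
    by (auto intro!: derivative_eq_intros)
  from DERIV_chain2[OF smooth_step_deriv this] show ?thesis by simp
qed simp

text \<open>The rescaled tents at \<open>x\<close> form an approximate identity supported on the right of \<open>x\<close>.\<close>

lemma hat_kernel_approx:
  fixes U :: "real \<Rightarrow> real"
  assumes U: "continuous_on {a..b} U" and x: "a \<le> x" "x < b" and "0 < \<eta>"
  shows "\<exists>\<delta>>0. \<forall>\<epsilon>. 0 < \<epsilon> \<and> \<epsilon> < \<delta> \<longrightarrow>
    \<bar>integral {a..b} (\<lambda>t. U t * (hat ((t - x) / \<epsilon>) / \<epsilon>)) - U x\<bar> \<le> \<eta>"
proof -
  obtain d where d: "d > 0" "\<And>t. t \<in> {a..b} \<Longrightarrow> dist t x < d \<Longrightarrow> dist (U t) (U x) < \<eta>"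
    using U x \<open>0 < \<eta>\<close> unfolding continuous_on_iff by (metis atLeastAtMost_iff less_imp_le)
  show ?thesis
  proof (intro exI[of _ "min d (b - x)"] conjI allI impI)
    show "0 < min d (b - x)" using d(1) x by simp
    fix \<epsilon> assume "0 < \<epsilon> \<and> \<epsilon> < min d (b - x)"
    then have \<epsilon>: "0 < \<epsilon>" "\<epsilon> < d" "\<epsilon> < b - x" by auto
    define k where "k t = hat ((t - x) / \<epsilon>) / \<epsilon>" for t
    have k0: "0 \<le> k t" for t using \<epsilon>(1) hat_nonneg by (simp add: k_def)
    have kc: "continuous_on {a..b} k"
      unfolding k_def by (intro continuous_intros continuous_on_compose2[OF continuous_on_hat[of UNIV]]) (use \<epsilon> in auto)
    have "(k has_integral smooth_step ((b - x) / \<epsilon>) - smooth_step ((a - x) / \<epsilon>)) {a..b}"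
      unfolding k_def
      using x by (intro fundamental_theorem_of_calculus)
        (auto intro: smooth_step_rescale_deriv has_field_derivative_at_within simp: has_real_derivative_iff_has_vector_derivative[symmetric])
    moreover have "smooth_step ((b - x) / \<epsilon>) = 1" using \<epsilon> by (intro smooth_step_1) (simp add: field_simps)
    moreover have "smooth_step ((a - x) / \<epsilon>) = 0" using \<epsilon> x by (intro smooth_step_0) (simp add: field_simps)
    ultimately have k1: "(k has_integral 1) {a..b}" by simp
    have ck: "(\<lambda>t. c * k t) integrable_on {a..b}" for c
      using has_integral_mult_right[OF k1] by blast
    have Uk: "(\<lambda>t. U t * k t) integrable_on {a..b}"
      using U kc by (intro integrable_continuous_real continuous_intros)
    have "integral {a..b} (\<lambda>t. U t * k t) - U x = integral {a..b} (\<lambda>t. U t * k t) - integral {a..b} (\<lambda>t. U x * k t)"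
      using k1 by (simp add: integral_unique)
    also have "\<dots> = integral {a..b} (\<lambda>t. U t * k t - U x * k t)"
      using Uk ck by (intro integral_diff[symmetric])
    finally have "\<bar>integral {a..b} (\<lambda>t. U t * k t) - U x\<bar> = norm (integral {a..b} (\<lambda>t. U t * k t - U x * k t))"
      by simp
    also have "\<dots> \<le> integral {a..b} (\<lambda>t. \<eta> * k t)"
    proof (rule integral_norm_bound_integral)
      show "(\<lambda>t. U t * k t - U x * k t) integrable_on {a..b}"
        using Uk ck by (intro integrable_diff)
      show "(\<lambda>t. \<eta> * k t) integrable_on {a..b}" by (rule ck)
      fix t assume t: "t \<in> {a..b}"
      show "norm (U t * k t - U x * k t) \<le> \<eta> * k t"
      proof (cases "t \<in> {x..x + \<epsilon>}")
        case True
        then have "\<bar>U t - U x\<bar> \<le> \<eta>" using d(2)[OF t] \<epsilon> by (auto simp: dist_real_def)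
        then have "\<bar>U t - U x\<bar> * k t \<le> \<eta> * k t" using k0 by (rule mult_right_mono)
        moreover have "norm (U t * k t - U x * k t) = \<bar>U t - U x\<bar> * k t"
          using k0[of t] by (simp add: left_diff_distrib[symmetric] abs_mult)
        ultimately show ?thesis by simp
      next
        case False
        then have "(t - x) / \<epsilon> \<notin> {0..1}" using \<epsilon>(1) by (auto simp: field_simps)
        then have "k t = 0" by (simp add: k_def hat_0)
        then show ?thesis by simp
      qed
    qed
    also have "\<dots> = \<eta>" using k1 by (simp add: integral_unique)
    finally show "\<bar>integral {a..b} (\<lambda>t. U t * (hat ((t - x) / \<epsilon>) / \<epsilon>)) - U x\<bar> \<le> \<eta>"
      by (simp add: k_def)
  qed
qed

lemma hat_kernel_tendsto:
  fixes U :: "real \<Rightarrow> real"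
  assumes U: "continuous_on {a..b} U" and x: "a \<le> x" "x < b" and e: "e \<longlonglongrightarrow> 0" "\<And>n. 0 < e n"
  shows "(\<lambda>n. integral {a..b} (\<lambda>t. U t * (hat ((t - x) / e n) / e n))) \<longlonglongrightarrow> U x"
proof (rule tendstoI)
  fix r :: real assume "0 < r"
  then obtain \<delta> where \<delta>: "\<delta> > 0" "\<And>\<epsilon>. 0 < \<epsilon> \<Longrightarrow> \<epsilon> < \<delta> \<Longrightarrow>
    \<bar>integral {a..b} (\<lambda>t. U t * (hat ((t - x) / \<epsilon>) / \<epsilon>)) - U x\<bar> \<le> r / 2"
    using hat_kernel_approx[OF U x, of "r / 2"] by auto
  have "\<forall>\<^sub>F n in sequentially. e n < \<delta>" using e(1) \<delta>(1) by (rule order_tendstoD(2))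
  then show "\<forall>\<^sub>F n in sequentially. dist (integral {a..b} (\<lambda>t. U t * (hat ((t - x) / e n) / e n))) (U x) < r"
  proof eventually_elim
    case (elim n)
    from \<delta>(2)[OF e(2) elim] \<open>0 < r\<close> show ?case unfolding dist_real_def by linarith
  qed
qed

text \<open>The test functions rise smoothly from \<open>0\<close> to \<open>1\<close> at \<open>x\<close> and fall back at \<open>y\<close>. They tend
to the indicator function of \<open>{x<..y}\<close>, and their derivatives pick out \<open>U x - U y\<close> in the
limit.\<close>

lemma weak_derivative_increment_interior:
  assumes wd: "weak_derivative a b U V" and U: "continuous_on {a..b} U"
    and xy: "a < x" "x \<le> y" "y < b"
  shows "U y - U x = (LINT t:{x<..y}|lebesgue. V t)"
proof -
  have V: "integrable lebesgue (\<lambda>t. indicator {a..b} t * V t)"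
    and test: "\<And>\<phi>. C1c_test a b \<phi> \<Longrightarrow>
      (LINT t:{a..b}|lebesgue. U t * deriv \<phi> t) = - (LINT t:{a..b}|lebesgue. V t * \<phi> t)"
    using wd by (auto simp: weak_derivative_def set_integrable_def)
  have mV: "(\<lambda>t. indicator {a..b} t * V t) \<in> borel_measurable lebesgue"
    using V by (rule borel_measurable_integrable)
  \<comment> \<open>The factor \<open>2\<close> keeps the support \<open>[x, y + e n]\<close> of the test function inside \<open>(a, b)\<close>.\<close>
  define e where "e n = (b - y) / (2 * real (Suc n))" for n
  have e0: "0 < e n" for n using xy by (simp add: e_def)
  have e_le: "e n \<le> (b - y) / 2" for n
    unfolding e_def using xy by (intro divide_left_mono) auto
  have "(\<lambda>n. (b - y) / 2 * (1 / real (Suc n))) \<longlonglongrightarrow> (b - y) / 2 * 0"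
    using lim_1_over_n[THEN LIMSEQ_Suc] by (intro tendsto_mult tendsto_const) simp
  then have e_lim: "e \<longlonglongrightarrow> 0" by (simp add: e_def[abs_def] field_simps)
  define \<phi> where "\<phi> n t = smooth_step ((t - x) / e n) - smooth_step ((t - y) / e n)" for n t
  define k where "k z n t = hat ((t - z) / e n) / e n" for z n t
  have k_cont: "continuous_on A (k z n)" for A z n
    unfolding k_def by (intro continuous_intros continuous_on_compose2[OF continuous_on_hat[of UNIV]])
      (use e0[of n] in auto)
  have \<phi>_deriv: "(\<phi> n has_real_derivative k x n t - k y n t) (at t)" for n t
    unfolding \<phi>_def k_def by (intro DERIV_diff smooth_step_rescale_deriv)
  have \<phi>_test: "C1c_test a b (\<phi> n)" for n
    unfolding C1c_test_def
  proof
    show "\<phi> n C1_differentiable_on UNIV"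
      unfolding C1_differentiable_on_def
      using \<phi>_deriv k_cont
      by (intro exI[of _ "\<lambda>t. k x n t - k y n t"])
        (auto simp: has_real_derivative_iff_has_vector_derivative[symmetric] intro!: continuous_intros)
    show "\<exists>K. compact K \<and> K \<subseteq> {a<..<b} \<and> (\<forall>t. t \<notin> K \<longrightarrow> \<phi> n t = 0)"
    proof (intro exI[of _ "{x..y + e n}"] conjI allI impI)
      show "{x..y + e n} \<subseteq> {a<..<b}" using xy e_le[of n] by auto
      fix t assume "t \<notin> {x..y + e n}"
      then consider "t < x" | "y + e n < t" by fastforce
      then show "\<phi> n t = 0"
      proof cases
        case 1
        then have "(t - x) / e n \<le> 0" "(t - y) / e n \<le> 0" using e0[of n] xy by (auto simp: divide_le_0_iff)
        then show ?thesis by (simp add: \<phi>_def smooth_step_0)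
      next
        case 2
        then have "1 \<le> (t - x) / e n" "1 \<le> (t - y) / e n" using e0[of n] xy by (auto simp: field_simps)
        then show ?thesis by (simp add: \<phi>_def smooth_step_1)
      qed
    qed simp
  qed
  have lhs: "(LINT t:{a..b}|lebesgue. U t * deriv (\<phi> n) t)
      = integral {a..b} (\<lambda>t. U t * k x n t) - integral {a..b} (\<lambda>t. U t * k y n t)" for n
  proof -
    have d: "deriv (\<phi> n) t = k x n t - k y n t" for t using \<phi>_deriv by (rule DERIV_imp_deriv)
    have c: "continuous_on {a..b} (\<lambda>t. U t * k z n t)" for z using U k_cont by (intro continuous_intros)
    have "(\<lambda>t. U t * (k x n t - k y n t)) absolutely_integrable_on {a..b}"
      using U k_cont by (intro absolutely_integrable_continuous_real continuous_intros)
    then have "(LINT t:{a..b}|lebesgue. U t * deriv (\<phi> n) t) = integral {a..b} (\<lambda>t. U t * (k x n t - k y n t))"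
      unfolding d by (rule set_lebesgue_integral_eq_integral(2))
    also have "\<dots> = integral {a..b} (\<lambda>t. U t * k x n t) - integral {a..b} (\<lambda>t. U t * k y n t)"
      unfolding right_diff_distrib using c by (intro integral_diff integrable_continuous_real)
    finally show ?thesis .
  qed
  have "(\<lambda>n. integral {a..b} (\<lambda>t. U t * k x n t) - integral {a..b} (\<lambda>t. U t * k y n t)) \<longlonglongrightarrow> U x - U y"
    unfolding k_def using xy by (intro tendsto_diff hat_kernel_tendsto[OF U _ _ e_lim e0]) auto
  then have l1: "(\<lambda>n. - (LINT t:{a..b}|lebesgue. V t * \<phi> n t)) \<longlonglongrightarrow> U x - U y"
    using test[OF \<phi>_test] lhs by simp
  have l2: "(\<lambda>n. LINT t|lebesgue. (indicator {a..b} t * V t) * \<phi> n t)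
      \<longlonglongrightarrow> (LINT t|lebesgue. (indicator {a..b} t * V t) * indicator {x<..y} t)"
  proof (rule integral_dominated_convergence[where w = "\<lambda>t. \<bar>indicator {a..b} t * V t\<bar>"])
    show "integrable lebesgue (\<lambda>t. \<bar>indicator {a..b} t * V t\<bar>)" using V by (rule integrable_abs)
    show "(\<lambda>t. (indicator {a..b} t * V t) * indicator {x<..y} t) \<in> borel_measurable lebesgue"
      using mV by (rule borel_measurable_times) (auto intro: borel_measurable_indicator)
    have "continuous_on UNIV (\<phi> n)" for n
      using \<phi>_deriv by (auto intro!: DERIV_isCont continuous_at_imp_continuous_on)
    then have "\<phi> n \<in> borel_measurable borel" for n by (rule borel_measurable_continuous_onI)
    then have m\<phi>: "\<phi> n \<in> borel_measurable lebesgue" for n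
      using measurable_completion[of "\<phi> n" lborel borel] by simp
    show "(\<lambda>t. (indicator {a..b} t * V t) * \<phi> n t) \<in> borel_measurable lebesgue" for n
      using mV m\<phi> by (rule borel_measurable_times)
    show "AE t in lebesgue. norm ((indicator {a..b} t * V t) * \<phi> n t) \<le> \<bar>indicator {a..b} t * V t\<bar>" for n
    proof (intro AE_I2)
      fix t
      have "\<bar>\<phi> n t\<bar> \<le> 1"
        using smooth_step_bounds[of "(t - x) / e n"] smooth_step_bounds[of "(t - y) / e n"] by (auto simp: \<phi>_def)
      then show "norm ((indicator {a..b} t * V t) * \<phi> n t) \<le> \<bar>indicator {a..b} t * V t\<bar>"
        by (auto simp: abs_mult intro!: mult_left_le)
    qed
    have step: "(\<lambda>n. smooth_step ((t - z) / e n)) \<longlonglongrightarrow> (if z < t then 1 else 0)" for t z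
    proof (rule tendsto_eventually)
      show "\<forall>\<^sub>F n in sequentially. smooth_step ((t - z) / e n) = (if z < t then 1 else 0)"
      proof (cases "z < t")
        case True
        then have "\<forall>\<^sub>F n in sequentially. e n < t - z" using e_lim by (intro order_tendstoD(2)) auto
        then show ?thesis
        proof eventually_elim
          case (elim n)
          then have "1 \<le> (t - z) / e n" using e0[of n] by (simp add: field_simps)
          then show ?case using True by (simp add: smooth_step_1)
        qed
      next
        case False
        then have "(t - z) / e n \<le> 0" for n using e0[of n] by (simp add: divide_le_0_iff)
        then show ?thesis using False by (simp add: smooth_step_0)
      qed
    qed
    show "AE t in lebesgue. (\<lambda>n. (indicator {a..b} t * V t) * \<phi> n t)
        \<longlonglongrightarrow> (indicator {a..b} t * V t) * indicator {x<..y} t"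
    proof (intro AE_I2 tendsto_mult tendsto_const)
      fix t
      have "(\<lambda>n. \<phi> n t) \<longlonglongrightarrow> (if x < t then 1 else 0) - (if y < t then 1 else 0)"
        unfolding \<phi>_def by (intro tendsto_diff step)
      moreover have "(if x < t then 1 else 0) - (if y < t then 1 else 0) = (indicator {x<..y} t :: real)"
        using xy by (auto simp: indicator_def)
      ultimately show "(\<lambda>n. \<phi> n t) \<longlonglongrightarrow> indicator {x<..y} t" by simp
    qed
  qed
  have "(\<lambda>n. - (LINT t:{a..b}|lebesgue. V t * \<phi> n t))
      \<longlonglongrightarrow> - (LINT t|lebesgue. (indicator {a..b} t * V t) * indicator {x<..y} t)"
    using tendsto_minus[OF l2] by (simp add: set_lebesgue_integral_def mult_ac)
  then have "U x - U y = - (LINT t|lebesgue. (indicator {a..b} t * V t) * indicator {x<..y} t)"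
    using l1 LIMSEQ_unique by blast
  also have "(LINT t|lebesgue. (indicator {a..b} t * V t) * indicator {x<..y} t) = (LINT t:{x<..y}|lebesgue. V t)"
    unfolding set_lebesgue_integral_def using xy
    by (intro Bochner_Integration.integral_cong) (auto simp: indicator_def)
  finally show ?thesis by simp
qed

lemma weak_derivative_increment_le:
  assumes wd: "weak_derivative a b U V" and U: "continuous_on {a..b} U"
    and xy: "a \<le> x" "x \<le> y" "y \<le> b"
  shows "ennreal \<bar>U y - U x\<bar> \<le> (\<integral>\<^sup>+t\<in>{x..y}. ennreal \<bar>V t\<bar> \<partial>lebesgue)"
proof (cases "x = y")
  case False
  with xy have "x < y" by simp
  have V: "V absolutely_integrable_on {a..b}" using wd by (simp add: weak_derivative_def)
  have inner: "ennreal \<bar>U w - U z\<bar> \<le> (\<integral>\<^sup>+t\<in>{x..y}. ennreal \<bar>V t\<bar> \<partial>lebesgue)"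
    if "x < z" "z \<le> w" "w < y" for z w
  proof -
    have "V absolutely_integrable_on {z<..w}"
      using V by (rule set_integrable_subset) (use that xy in auto)
    then have int: "integrable lebesgue (\<lambda>t. indicator {z<..w} t *\<^sub>R V t)" by (simp add: set_integrable_def)
    have "U w - U z = (LINT t:{z<..w}|lebesgue. V t)"
      using weak_derivative_increment_interior[OF wd U] that xy by simp
    then have "ennreal \<bar>U w - U z\<bar> \<le> (\<integral>\<^sup>+t. ennreal (norm (indicator {z<..w} t *\<^sub>R V t)) \<partial>lebesgue)"
      using integral_norm_bound_ennreal[OF int] by (simp add: set_lebesgue_integral_def)
    also have "\<dots> \<le> (\<integral>\<^sup>+t\<in>{x..y}. ennreal \<bar>V t\<bar> \<partial>lebesgue)"
      using that by (intro nn_integral_mono) (auto simp: indicator_def)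
    finally show ?thesis .
  qed
  \<comment> \<open>The denominator \<open>n + 3\<close> keeps \<open>x + h n < y - h n\<close>.\<close>
  define h where "h n = (y - x) / real (n + 3)" for n
  have h: "0 < h n" "h n \<le> (y - x) / 3" for n
    unfolding h_def using \<open>x < y\<close> by (simp, intro divide_left_mono) auto
  have "h \<longlonglongrightarrow> 0"
    unfolding h_def[abs_def] using LIMSEQ_ignore_initial_segment[OF lim_const_over_n[of "y - x"], of 3] by simp
  then have lims: "(\<lambda>n. x + h n) \<longlonglongrightarrow> x" "(\<lambda>n. y - h n) \<longlonglongrightarrow> y"
    using tendsto_add[OF tendsto_const[of x], of h 0] tendsto_diff[OF tendsto_const[of y], of h 0] by auto
  have mem: "x + h n \<in> {a..b}" "y - h n \<in> {a..b}" for n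
    using h[of n] xy \<open>x < y\<close> by (auto simp: field_simps)
  have "(\<lambda>n. U (x + h n)) \<longlonglongrightarrow> U x" "(\<lambda>n. U (y - h n)) \<longlonglongrightarrow> U y"
    using continuous_on_tendsto_compose[OF U lims(1)] continuous_on_tendsto_compose[OF U lims(2)] mem xy by auto
  then have lim: "(\<lambda>n. ennreal \<bar>U (y - h n) - U (x + h n)\<bar>) \<longlonglongrightarrow> ennreal \<bar>U y - U x\<bar>"
    by (intro tendsto_ennrealI tendsto_rabs tendsto_diff)
  have "ennreal \<bar>U (y - h n) - U (x + h n)\<bar> \<le> (\<integral>\<^sup>+t\<in>{x..y}. ennreal \<bar>V t\<bar> \<partial>lebesgue)" for n
    using h[of n] \<open>x < y\<close> by (intro inner) (auto simp: field_simps)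
  then show ?thesis by (intro LIMSEQ_le_const2[OF lim]) blast
qed simp

section \<open>A conditional Jensen inequality\<close>

text \<open>Slopes of supporting lines at all points of the half line, chosen in a monotone (hence
Borel) way. At the boundary point \<open>0\<close> the slope \<open>0\<close> is admissible because \<open>f\<close> is
nondecreasing.\<close>

lemma convex_mono_tangent_slope:
  fixes f :: "real \<Rightarrow> real"
  assumes f: "convex_on {0..} f" "mono_on {0..} f"
  obtains q :: "real \<Rightarrow> real" where "mono q" "\<And>t. 0 \<le> q t"
    "\<And>t v. 0 \<le> t \<Longrightarrow> 0 \<le> v \<Longrightarrow> f t + q t * (v - t) \<le> f v"
proof -
  define q where "q t = (if t \<le> 0 then 0 else Inf ((\<lambda>v. (f t - f v) / (t - v)) ` ({t<..} \<inter> {0..})))" for t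
  have tangent: "f t + q t * (v - t) \<le> f v" if "0 \<le> t" "0 \<le> v" for t v
  proof (cases "t = 0")
    case True
    then show ?thesis using that monotone_onD[OF f(2), of 0 v] by (simp add: q_def)
  next
    case False
    then show ?thesis using that convex_le_Inf_differential[OF f(1), of t v]
      by (simp add: q_def interior_real_atLeast)
  qed
  have nonneg: "0 \<le> q t" for t
  proof (cases "t \<le> 0")
    case False
    then have "f t \<le> f 0 + q t * t" using tangent[of t 0] by simp
    moreover have "f 0 \<le> f t" using False by (intro monotone_onD[OF f(2)]) auto
    ultimately have "0 \<le> q t * t" by linarith
    with False show ?thesis by (simp add: zero_le_mult_iff)
  qed (simp add: q_def)
  have "q s \<le> q t" if "s \<le> t" for s t
  proof (cases "s \<le> 0 \<or> s = t")
    case True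
    moreover have "q s = 0" if "s \<le> 0" using that by (simp add: q_def)
    ultimately show ?thesis using nonneg[of t] by auto
  next
    case False
    then have "f s + q s * (t - s) \<le> f t" "f t + q t * (s - t) \<le> f s"
      using that by (auto intro!: tangent)
    then have "q s * (t - s) \<le> q t * (t - s)" by (simp add: algebra_simps)
    with False that show ?thesis by (simp add: mult_le_cancel_right)
  qed
  then show thesis using that[of q] nonneg tangent by (simp add: mono_def)
qed

text \<open>The hypothesis on all \<open>g\<close> says that \<open>s(u)\<close> is at most the conditional expectation of \<open>W\<close>
given \<open>u\<close>. For the truncations \<open>r\<close> of \<open>s\<close> at height \<open>k\<close> the supporting line inequality
\<open>f(r) + q(r) * W \<le> f(W) + q(r) * r\<close> can be integrated, and the finite integral of
\<open>q(r) * r\<close> cancels.\<close>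

theorem Jensen_conditional_bound:
  fixes f :: "real \<Rightarrow> real" and u W :: "'a \<Rightarrow> real" and s :: "real \<Rightarrow> ennreal"
  assumes "finite_measure M"
    and f: "\<And>t. 0 \<le> t \<Longrightarrow> 0 \<le> f t" "convex_on {0..} f" "mono_on {0..} f"
    and u[measurable]: "u \<in> borel_measurable M"
    and W[measurable]: "W \<in> borel_measurable M" and W0: "\<And>x. 0 \<le> W x"
    and s[measurable]: "s \<in> borel_measurable borel" and fin: "AE x in M. s (u x) < \<infinity>"
    and le: "\<And>g. g \<in> borel_measurable borel \<Longrightarrow>
      (\<integral>\<^sup>+x. g (u x) * s (u x) \<partial>M) \<le> (\<integral>\<^sup>+x. g (u x) * ennreal (W x) \<partial>M)"
  shows "(\<integral>\<^sup>+x. ennreal (f (enn2real (s (u x)))) \<partial>M) \<le> (\<integral>\<^sup>+x. ennreal (f (W x)) \<partial>M)"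
proof -
  interpret finite_measure M by fact
  obtain q where q: "mono q" "\<And>t. 0 \<le> q t" "\<And>t v. 0 \<le> t \<Longrightarrow> 0 \<le> v \<Longrightarrow> f t + q t * (v - t) \<le> f v"
    using convex_mono_tangent_slope[OF f(2,3)] by blast
  have [measurable]: "q \<in> borel_measurable borel" using q(1) by (rule borel_measurable_mono)
  define F where "F t = f (max 0 t)" for t
  have "mono F" unfolding F_def by (intro monoI monotone_onD[OF f(3)]) auto
  then have [measurable]: "F \<in> borel_measurable borel" by (rule borel_measurable_mono)
  have F: "F t = f t" if "0 \<le> t" for t using that by (simp add: F_def)
  have F0: "0 \<le> F t" for t by (simp add: F_def f(1))
  define r where "r k y = enn2real (min (s y) (of_nat k))" for k :: nat and y
  have [measurable]: "r k \<in> borel_measurable borel" for k unfolding r_def by measurable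
  have r0: "0 \<le> r k y" for k y by (simp add: r_def)
  have rk: "r k y \<le> real k" for k y
    unfolding r_def by (rule enn2real_leI) (auto simp: ennreal_of_nat_eq_real_of_nat)
  have rs: "ennreal (r k y) \<le> s y" for k y
  proof -
    have "min (s y) (of_nat k) < top" by (auto simp: min_def less_top[symmetric] of_nat_less_top top_unique)
    then show ?thesis by (simp add: r_def)
  qed
  have step: "(\<integral>\<^sup>+x. ennreal (F (r k (u x))) \<partial>M) \<le> (\<integral>\<^sup>+x. ennreal (F (W x)) \<partial>M)" for k
  proof -
    define c where "c = (\<integral>\<^sup>+x. ennreal (q (r k (u x)) * r k (u x)) \<partial>M)"
    have "c \<le> (\<integral>\<^sup>+x. ennreal (q (real k) * real k) \<partial>M)"
      unfolding c_def using q(2) r0 rk monoD[OF q(1)]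
      by (intro nn_integral_mono ennreal_leI mult_mono) auto
    also have "\<dots> < \<infinity>" by (simp add: less_top[symmetric] ennreal_mult_eq_top_iff)
    finally have c: "c < \<infinity>" .
    have "c \<le> (\<integral>\<^sup>+x. ennreal (q (r k (u x))) * s (u x) \<partial>M)"
      unfolding c_def using q(2) r0 rs by (intro nn_integral_mono) (simp add: ennreal_mult mult_left_mono)
    also have "\<dots> \<le> (\<integral>\<^sup>+x. ennreal (q (r k (u x))) * ennreal (W x) \<partial>M)"
      using le[of "\<lambda>y. ennreal (q (r k y))"] by simp
    finally have "(\<integral>\<^sup>+x. ennreal (F (r k (u x))) \<partial>M) + c
        \<le> (\<integral>\<^sup>+x. ennreal (F (r k (u x))) \<partial>M) + (\<integral>\<^sup>+x. ennreal (q (r k (u x))) * ennreal (W x) \<partial>M)"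
      by (rule add_left_mono)
    also have "\<dots> = (\<integral>\<^sup>+x. ennreal (F (r k (u x))) + ennreal (q (r k (u x))) * ennreal (W x) \<partial>M)"
      by (rule nn_integral_add[symmetric]) measurable
    also have "\<dots> \<le> (\<integral>\<^sup>+x. ennreal (F (W x)) + ennreal (q (r k (u x)) * r k (u x)) \<partial>M)"
    proof (rule nn_integral_mono)
      fix x
      have "F (r k (u x)) + q (r k (u x)) * W x \<le> F (W x) + q (r k (u x)) * r k (u x)"
        using q(3)[OF r0 W0, of k "u x" x] r0 W0 by (simp add: F algebra_simps)
      then show "ennreal (F (r k (u x))) + ennreal (q (r k (u x))) * ennreal (W x)
          \<le> ennreal (F (W x)) + ennreal (q (r k (u x)) * r k (u x))"
        using F0 q(2) r0 W0 by (simp add: ennreal_mult[symmetric] ennreal_plus[symmetric] del: ennreal_plus)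
    qed
    also have "\<dots> = (\<integral>\<^sup>+x. ennreal (F (W x)) \<partial>M) + c"
      unfolding c_def by (rule nn_integral_add) measurable
    finally show ?thesis using c by (auto simp: add.commute[of _ c] ennreal_add_left_cancel_le)
  qed
  have "(\<integral>\<^sup>+x. ennreal (f (enn2real (s (u x)))) \<partial>M)
      \<le> (\<integral>\<^sup>+x. liminf (\<lambda>k. ennreal (F (r k (u x)))) \<partial>M)"
  proof (rule nn_integral_mono_AE, use fin in eventually_elim)
    case (elim x)
    then obtain t where t: "s (u x) = ennreal t" "0 \<le> t" by (cases "s (u x)") auto
    have "\<forall>\<^sub>F k in sequentially. ennreal (f (enn2real (s (u x)))) \<le> ennreal (F (r k (u x)))"
      using eventually_ge_at_top[of "nat \<lceil>t\<rceil>"]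
    proof eventually_elim
      case (elim k)
      then have "t \<le> real k" by linarith
      then have "r k (u x) = t" using t by (simp add: r_def ennreal_of_nat_eq_real_of_nat min_def)
      then show ?case using t by (simp add: F)
    qed
    then show ?case by (rule Liminf_bounded)
  qed
  also have "\<dots> \<le> liminf (\<lambda>k. \<integral>\<^sup>+x. ennreal (F (r k (u x))) \<partial>M)"
    by (rule nn_integral_liminf) measurable
  also have "\<dots> \<le> liminf (\<lambda>k::nat. \<integral>\<^sup>+x. ennreal (F (W x)) \<partial>M)"
    using step by (intro Liminf_mono) simp
  also have "\<dots> = (\<integral>\<^sup>+x. ennreal (f (W x)) \<partial>M)" using W0 by (simp add: Liminf_const F)
  finally show ?thesis .
qed

section \<open>Comparison with the monotone rearrangement\<close>

lemma countable_flat_values_mono: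
  fixes F :: "real \<Rightarrow> real"
  assumes F: "mono F"
  shows "countable {y. \<exists>x x'. x < x' \<and> F x = y \<and> F x' = y}"
proof (rule countable_subset)
  show "{y. \<exists>x x'. x < x' \<and> F x = y \<and> F x' = y} \<subseteq> F ` \<rat>"
  proof
    fix y assume "y \<in> {y. \<exists>x x'. x < x' \<and> F x = y \<and> F x' = y}"
    then obtain x x' where x: "x < x'" "F x = y" "F x' = y" by blast
    obtain q where q: "q \<in> \<rat>" "x < q" "q < x'" using Rats_dense_in_real[OF x(1)] by blast
    then have "F q = y" using monoD[OF F, of x q] monoD[OF F, of q x'] x by simp
    with q(1) show "y \<in> F ` \<rat>" by blast
  qed
  show "countable (F ` \<rat>)" using countable_rat by (rule countable_image)
qed

text \<open>A monotone left inverse of \<open>F\<close> at all points to the left of which the value is not taken.\<close>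

lemma mono_left_inverse:
  fixes F :: "real \<Rightarrow> real"
  assumes F: "mono F" and "a \<le> b"
  obtains S :: "real \<Rightarrow> real" where "mono S"
    "\<And>x. a < x \<Longrightarrow> x \<le> b \<Longrightarrow> (\<And>z. z < x \<Longrightarrow> F z \<noteq> F x) \<Longrightarrow> S (F x) = x"
proof -
  define A where "A y = insert a {x \<in> {a..b}. F x < y}" for y
  have bdd: "bdd_above (A y)" for y using \<open>a \<le> b\<close> by (intro bdd_aboveI[of _ b]) (auto simp: A_def)
  have "mono (\<lambda>y. Sup (A y))"
  proof (rule monoI)
    fix y y' :: real assume "y \<le> y'"
    then show "Sup (A y) \<le> Sup (A y')" by (intro cSup_subset_mono bdd) (auto simp: A_def)
  qed
  moreover have "Sup (A (F x)) = x" if x: "a < x" "x \<le> b" "\<And>z. z < x \<Longrightarrow> F z \<noteq> F x" for x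
  proof (rule antisym)
    have "z \<le> x" if "F z < F x" for z using that monoD[OF F, of x z] by (meson leD le_cases)
    then show "Sup (A (F x)) \<le> x" using x(1) by (intro cSup_least) (auto simp: A_def)
    show "x \<le> Sup (A (F x))"
    proof (rule dense_le_bounded[OF x(1)])
      fix z assume z: "a < z" "z < x"
      then have "F z < F x" using monoD[OF F, of z x] x(3)[of z] by simp
      with z x(2) show "z \<le> Sup (A (F x))" by (intro cSup_upper bdd) (auto simp: A_def)
    qed
  qed
  ultimately show thesis using that by blast
qed

theorem theorem3p1:
  fixes a b :: real and f U U' T :: "real \<Rightarrow> real"
  assumes "a \<le> b"
    and "\<And>t. 0 \<le> t \<Longrightarrow> 0 \<le> f t"
    and "convex_on {0..} f"
    and "mono_on {0..} f"
    and "U \<in> W11 a b"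
    and "continuous_on {a..b} U"
    and "weak_derivative a b U U'"
    and "(\<integral>\<^sup>+x\<in>{a..b}. ennreal (f \<bar>U' x\<bar>) \<partial>lebesgue) < \<infinity>"
    and "mono_on {a..b} T"
    and "distr (lebesgue_on {a..b}) borel T = distr (lebesgue_on {a..b}) borel U"
  shows "(\<integral>\<^sup>+x\<in>{a..b}. ennreal (f \<bar>U' x\<bar>) \<partial>lebesgue)
       \<ge> (\<integral>\<^sup>+x\<in>{a..b}. extend_inf f (level_count a b U (T x) * ennreal (deriv T x)) \<partial>lebesgue)"
proof -
  note f = assms(2-4)
  define M where "M = lebesgue_on {a..b}"
  have M_leb: "(\<integral>\<^sup>+x. h x \<partial>M) = (\<integral>\<^sup>+x\<in>{a..b}. h x \<partial>lebesgue)" for h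
    by (simp add: M_def nn_integral_restrict_space)
  have M_lborel: "(\<integral>\<^sup>+x. h x \<partial>M) = (\<integral>\<^sup>+x\<in>{a..b}. h x \<partial>lborel)" for h
    by (simp add: M_leb nn_integral_completion)
  have M_meas: "h \<in> borel_measurable M" if "h \<in> borel_measurable borel" for h :: "real \<Rightarrow> real"
    using that by (simp add: M_def measurable_restrict_space1 measurable_completion)
  have M_fin: "finite_measure M"
    by (intro finite_measureI) (simp add: M_def emeasure_restrict_space \<open>a \<le> b\<close>)
  have AE_M: "AE x in M. P x" if "AE x in lebesgue. x \<in> {a..b} \<longrightarrow> P x" for P
    using that unfolding M_def by (subst AE_restrict_space_iff) auto
  \<comment> \<open>Extend \<open>U\<close> and \<open>T\<close> by constants to the whole line; this changes nothing in the interior of \<open>[a, b]\<close>.\<close>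
  define c where "c x = max a (min b x)" for x
  have c_in: "c x \<in> {a..b}" for x using \<open>a \<le> b\<close> by (auto simp: c_def)
  have c_id: "c x = x" if "x \<in> {a..b}" for x using that by (auto simp: c_def)
  have c_mono: "mono c" by (auto simp: c_def mono_def)
  have c_cont: "continuous_on UNIV c" unfolding c_def[abs_def] by (intro continuous_intros)
  define U0 where "U0 x = U (c x)" for x
  define T0 where "T0 x = T (c x)" for x
  have U0_cont: "continuous_on UNIV U0"
    unfolding U0_def[abs_def] using continuous_on_compose2[OF assms(6) c_cont] c_in by blast
  then have U0[measurable]: "U0 \<in> borel_measurable borel" by (rule borel_measurable_continuous_onI)
  have T0_mono: "mono T0"
    unfolding T0_def using c_in c_mono by (intro monoI monotone_onD[OF assms(9)]) (auto simp: mono_def)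
  then have T0[measurable]: "T0 \<in> borel_measurable borel" by (rule borel_measurable_mono)
  have distr_eq: "distr M borel T0 = distr M borel U0"
  proof -
    have "distr M borel T0 = distr M borel T" "distr M borel U0 = distr M borel U"
      by (auto intro!: distr_cong simp: T0_def U0_def M_def c_id)
    then show ?thesis using assms(10) by (simp add: M_def)
  qed
  have transfer: "(\<integral>\<^sup>+x. h (T0 x) \<partial>M) = (\<integral>\<^sup>+x. h (U0 x) \<partial>M)" if "h \<in> borel_measurable borel" for h
    using nn_integral_distr[OF M_meas[OF T0], of h] nn_integral_distr[OF M_meas[OF U0], of h] distr_eq that by simp

  have V: "integrable lebesgue (\<lambda>x. indicator {a..b} x * U' x)"
    using assms(7) by (simp add: weak_derivative_def set_integrable_def)
  \<comment> \<open>A Borel version of the weak derivative, equal to \<open>0\<close> almost everywhere outside \<open>[a, b]\<close>.\<close>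
  obtain V where V_borel[measurable]: "V \<in> borel_measurable borel"
    and V_AE: "AE x in lborel. indicator {a..b} x * U' x = V x"
    using completion_ex_borel_measurable_real[of "\<lambda>x. indicator {a..b} x * U' x" lborel]
      borel_measurable_integrable[OF V] by auto
  have V_AE': "AE x in lebesgue. indicator {a..b} x * U' x = V x"
    using V_AE by (rule AE_completion)
  define W where "W x = \<bar>V x\<bar>" for x
  have W[measurable]: "W \<in> borel_measurable borel" unfolding W_def[abs_def] by measurable
  have W_fin: "(\<integral>\<^sup>+x. ennreal (W x) \<partial>lborel) < \<infinity>"
  proof -
    have "(\<integral>\<^sup>+x. ennreal (W x) \<partial>lborel) = (\<integral>\<^sup>+x. ennreal (norm (indicator {a..b} x * U' x)) \<partial>lebesgue)"
      unfolding nn_integral_completion W_def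
      by (intro nn_integral_cong_AE) (use V_AE in \<open>auto elim!: eventually_mono\<close>)
    then show ?thesis using V by (simp add: integrable_iff_bounded)
  qed
  have grad: "ennreal \<bar>U0 y - U0 x\<bar> \<le> (\<integral>\<^sup>+t\<in>{x..y}. ennreal (W t) \<partial>lborel)" if "x \<le> y" for x y
  proof (cases "c x = c y")
    case False
    have "c x \<le> c y" using c_mono that by (simp add: mono_def)
    then have "ennreal \<bar>U0 y - U0 x\<bar> \<le> (\<integral>\<^sup>+t\<in>{c x..c y}. ennreal \<bar>U' t\<bar> \<partial>lebesgue)"
      unfolding U0_def using c_in
      by (intro weak_derivative_increment_le[OF assms(7,6)]) auto
    also have "\<dots> \<le> (\<integral>\<^sup>+t\<in>{x..y}. ennreal (W t) \<partial>lborel)"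
      unfolding nn_integral_completion
    proof (rule nn_integral_mono_AE, use V_AE in eventually_elim)
      case (elim t)
      show ?case
      proof (cases "t \<in> {c x..c y}")
        case True
        moreover have "t \<in> {a..b}" using True c_in[of x] c_in[of y] by auto
        moreover have "t \<in> {x..y}" using True \<open>c x \<noteq> c y\<close> \<open>x \<le> y\<close> \<open>a \<le> b\<close>
          by (auto simp: c_def min_def max_def split: if_splits)
        ultimately show ?thesis using elim by (simp add: W_def)
      qed simp
    qed
    finally show ?thesis .
  qed (simp add: U0_def)
  obtain N where N[measurable]: "N \<in> borel_measurable borel"
    and count: "\<And>y. level_count a b U0 y \<le> N y"
    and N_le: "\<And>g. g \<in> borel_measurable borel \<Longrightarrow>
       (\<integral>\<^sup>+y. g y * N y \<partial>lborel) \<le> (\<integral>\<^sup>+x\<in>{a..b}. g (U0 x) * ennreal (W x) \<partial>lborel)"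
    by (rule level_count_nn_integral_le[of "\<lambda>x. ennreal (W x)" U0 a b])
      (use W_fin U0_cont grad in auto)
  have level_eq: "level_count a b U0 = level_count a b U"
    by (auto simp: level_count_def U0_def c_id fun_eq_iff intro!: arg_cong[where f = "emeasure _"])

  obtain D where D[measurable]: "D \<in> borel_measurable borel"
    and D_eq: "\<And>x l. (T0 has_real_derivative l) (at x) \<Longrightarrow> D x = l"
    using mono_derivative_borel_version[OF T0_mono] by blast
  obtain S where "mono S" and S_inv:
    "\<And>x. a < x \<Longrightarrow> x \<le> b \<Longrightarrow> (\<And>z. z < x \<Longrightarrow> T0 z \<noteq> T0 x) \<Longrightarrow> S (T0 x) = x"
    using mono_left_inverse[OF T0_mono \<open>a \<le> b\<close>] by blast
  have [measurable]: "S \<in> borel_measurable borel" using \<open>mono S\<close> by (rule borel_measurable_mono)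
  \<comment> \<open>On the countable set \<open>C\<close> of values taken more than once the left inverse \<open>S\<close> is useless, so \<open>s\<close> is set to \<open>0\<close> there.\<close>
  define C where "C = {y. \<exists>x x'. x < x' \<and> T0 x = y \<and> T0 x' = y}"
  have "countable C" unfolding C_def by (rule countable_flat_values_mono[OF T0_mono])
  then have [measurable]: "C \<in> sets borel" by (rule sets.countable[rotated]) simp
  define s where "s y = (if y \<in> C then 0 else N y * ennreal (D (S y)))" for y
  have s[measurable]: "s \<in> borel_measurable borel" unfolding s_def[abs_def] by measurable
  \<comment> \<open>At \<open>C\<close> both sides vanish, as a positive derivative excludes a second point with the same value; elsewhere \<open>S\<close> recovers \<open>x\<close>.\<close>
  have s_eq: "s (T0 x) = N (T0 x) * ennreal (deriv T0 x)" if "a < x" "x < b" "T0 differentiable at x" for x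
  proof -
    have der: "(T0 has_real_derivative deriv T0 x) (at x)"
      using that(3) by (simp add: DERIV_deriv_iff_real_differentiable)
    show ?thesis
    proof (cases "T0 x \<in> C")
      case True
      then obtain z z' where zz': "z < z'" "T0 z = T0 x" "T0 z' = T0 x" unfolding C_def by blast
      then have "\<exists>z. z \<noteq> x \<and> T0 z = T0 x" by (metis less_irrefl)
      then obtain z where z: "z \<noteq> x" "T0 z = T0 x" by blast
      then have "\<not> 0 < deriv T0 x" using DERIV_pos_strict_mono_at[OF T0_mono der] by blast
      then have "ennreal (deriv T0 x) = 0" by (simp add: ennreal_neg)
      with True show ?thesis by (simp add: s_def)
    next
      case False
      then have "S (T0 x) = x" using that by (intro S_inv) (auto simp: C_def)
      with False D_eq[OF der] show ?thesis by (simp add: s_def)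
    qed
  qed
  have regular: "AE x in M. a < x \<and> x < b \<and> T0 differentiable at x"
  proof (rule AE_M)
    have "{x. \<not> T0 differentiable at x} \<union> {a, b} \<in> null_sets lebesgue"
      using negligible_mono_nondifferentiable[OF T0_mono]
      by (intro null_sets.Un) (auto simp: negligible_iff_null_sets[symmetric])
    from AE_not_in[OF this] show "AE x in lebesgue. x \<in> {a..b} \<longrightarrow> a < x \<and> x < b \<and> T0 differentiable at x"
      by eventually_elim auto
  qed

  have bound: "(\<integral>\<^sup>+x. g (U0 x) * s (U0 x) \<partial>M) \<le> (\<integral>\<^sup>+x. g (U0 x) * ennreal (W x) \<partial>M)"
    if g[measurable]: "g \<in> borel_measurable borel" for g
  proof -
    have "(\<integral>\<^sup>+x. g (U0 x) * s (U0 x) \<partial>M) = (\<integral>\<^sup>+x. g (T0 x) * s (T0 x) \<partial>M)"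
      by (rule transfer[symmetric]) measurable
    also have "\<dots> = (\<integral>\<^sup>+x. g (T0 x) * N (T0 x) * ennreal (deriv T0 x) \<partial>M)"
      by (rule nn_integral_cong_AE, use regular in eventually_elim) (simp add: s_eq mult.assoc)
    also have "\<dots> \<le> (\<integral>\<^sup>+x. g (T0 x) * N (T0 x) * ennreal (deriv T0 x) \<partial>lebesgue)"
      unfolding M_leb by (intro nn_integral_mono) (auto simp: indicator_def)
    also have "\<dots> \<le> (\<integral>\<^sup>+y. g y * N y \<partial>lborel)"
      by (rule nn_integral_mono_substitution_le[OF T0_mono]) measurable
    also have "\<dots> \<le> (\<integral>\<^sup>+x. g (U0 x) * ennreal (W x) \<partial>M)"
      unfolding M_lborel by (rule N_le) measurable
    finally show ?thesis .
  qed
  have s_int: "(\<integral>\<^sup>+x. s (U0 x) \<partial>M) < \<infinity>"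
  proof -
    have "(\<integral>\<^sup>+x. s (U0 x) \<partial>M) \<le> (\<integral>\<^sup>+x. ennreal (W x) \<partial>M)" using bound[of "\<lambda>_. 1"] by simp
    also have "\<dots> \<le> (\<integral>\<^sup>+x. ennreal (W x) \<partial>lborel)"
      unfolding M_lborel by (intro nn_integral_mono) (auto simp: indicator_def)
    finally show ?thesis using W_fin by (rule order.strict_trans1)
  qed
  have s_meas: "(\<lambda>x. s (h x)) \<in> borel_measurable M" if "h \<in> borel_measurable borel" for h
    using M_meas[OF that] s by (rule measurable_compose)
  have fin_U: "AE x in M. s (U0 x) < \<infinity>"
    using nn_integral_PInf_AE[OF s_meas[OF U0]] s_int by (auto simp: less_top elim!: eventually_mono)
  have fin_T: "AE x in M. s (T0 x) < \<infinity>"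
    using nn_integral_PInf_AE[OF s_meas[OF T0]] s_int transfer[OF s] by (auto simp: less_top elim!: eventually_mono)

  have "(\<integral>\<^sup>+x\<in>{a..b}. extend_inf f (level_count a b U (T x) * ennreal (deriv T x)) \<partial>lebesgue)
      \<le> (\<integral>\<^sup>+x. ennreal (f (enn2real (s (T0 x)))) \<partial>M)"
    unfolding M_leb[symmetric]
  proof (rule nn_integral_mono_AE, use regular fin_T in eventually_elim)
    case (elim x)
    then have x: "a < x" "x < b" "T0 differentiable at x" by auto
    have "\<forall>\<^sub>F z in nhds x. z \<in> {a<..<b}" using x by (intro eventually_nhds_in_open) auto
    then have "\<forall>\<^sub>F z in nhds x. T z = T0 z" by eventually_elim (simp add: T0_def c_id)
    then have "deriv T x = deriv T0 x" by (rule deriv_cong_ev) simp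
    moreover have "T x = T0 x" using x by (simp add: T0_def c_id)
    ultimately have le: "level_count a b U (T x) * ennreal (deriv T x) \<le> s (T0 x)"
      using count[of "T0 x"] x by (simp add: s_eq level_eq mult_right_mono)
    then have "level_count a b U (T x) * ennreal (deriv T x) < \<infinity>" using elim by (auto intro: order.strict_trans1)
    then have "extend_inf f (level_count a b U (T x) * ennreal (deriv T x))
        = ennreal (f (enn2real (level_count a b U (T x) * ennreal (deriv T x))))"
      by (auto simp: extend_inf_def)
    also have "\<dots> \<le> ennreal (f (enn2real (s (T0 x))))"
      using le elim by (intro ennreal_leI monotone_onD[OF f(3)] enn2real_mono) auto
    finally show ?case .
  qed
  also have "\<dots> = (\<integral>\<^sup>+x. ennreal (f (enn2real (s (U0 x)))) \<partial>M)"
  proof -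
    have "mono (\<lambda>t. f (max 0 t))" by (intro monoI monotone_onD[OF f(3)]) auto
    then have "(\<lambda>t. f (max 0 t)) \<in> borel_measurable borel" by (rule borel_measurable_mono)
    then have "(\<lambda>y. ennreal (f (max 0 (enn2real (s y))))) \<in> borel_measurable borel"
      using measurable_compose[of "\<lambda>y. enn2real (s y)" borel borel "\<lambda>t. f (max 0 t)" borel] by simp
    from transfer[OF this] show ?thesis by simp
  qed
  also have "\<dots> \<le> (\<integral>\<^sup>+x. ennreal (f (W x)) \<partial>M)"
    by (rule Jensen_conditional_bound[OF M_fin f M_meas[OF U0] M_meas[OF W] _ s fin_U bound])
      (simp_all add: W_def)
  also have "\<dots> = (\<integral>\<^sup>+x\<in>{a..b}. ennreal (f \<bar>U' x\<bar>) \<partial>lebesgue)"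
    unfolding M_leb
  proof (rule nn_integral_cong_AE, use V_AE' in eventually_elim)
    case (elim x)
    then show ?case by (cases "x \<in> {a..b}") (simp_all add: W_def)
  qed
  finally show ?thesis .
qed

end
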